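(* Let $G_0$ be a finite group, let $\omega$ be a normalized $U(1)$-valued 2-cocycle on $G_0$, and let $d_L,d_R$ be positive integers. Let $\{c_{L,g,R}\}$, with $L\in\{1,\dots,d_L\}$, $g\in G_0$, $R\in\{1,\dots,d_R\}$, be i.i.d. standard complex Gaussian random variables $\mathcal{CN}(0,1)$. Define the random $d_L|G_0|\times |G_0|d_R$ matrix $W$ whose rows are indexed by pairs $(L,g_l)$ and columns by pairs $(g_r,R)$ ($g_l,g_r\in G_0$), with entries $$W_{(L,g_l),(g_r,R)}=\frac{1}{\sqrt{|G_0|}}\,\omega(g_r,g_r^{-1}g_l)\,c_{L,\,g_r^{-1}g_l,\,R}.$$ Then there exist deterministic unitary matrices $U_1,U_2$ (independent of the $c$'s) such that $$U_1WU_2=\bigoplus_{\alpha}\mathbb{1}_{d_\alpha}\otimes \frac{1}{\sqrt{d_\alpha}}X_\alpha ,$$ where $\alpha$ runs over the inequivalent irreducible projective unitary representations of $G_0$ with cocycle $\omega$, $d_\alpha$ is the dimension of $\alpha$, and the $X_\alpha$ are mutually independent $d_Ld_\alpha\times d_Rd_\alpha$ random matrices with i.i.d. $\mathcal{CN}(0,1)$ entries. In particular, $WW^\dagger$ is unitarily equivalent to $\bigoplus_\alpha \mathbb{1}_{d_\alpha}\otimes d_\alpha^{-1}X_\alpha X_\alpha^\dagger$, a direct sum of independent Laguerre unitary ensemble (complex Wishart) blocks, each repeated $d_\alpha$ times. *)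

theory Defs
  imports "HOL-Probability.Probability" "HOL-Algebra.Group" "Jordan_Normal_Form.Matrix"
begin

definition cadj :: "complex mat \<Rightarrow> complex mat" where
  "cadj A = mat (dim_col A) (dim_row A) (\<lambda>(i,j). cnj (A $$ (j,i)))"

definition unitary_mat :: "nat \<Rightarrow> complex mat \<Rightarrow> bool" where
  "unitary_mat n U \<longleftrightarrow> U \<in> carrier_mat n n \<and> U * cadj U = 1\<^sub>m n \<and> cadj U * U = 1\<^sub>m n"

definition kron_id :: "nat \<Rightarrow> complex mat \<Rightarrow> complex mat" where
  "kron_id d A = mat (d * dim_row A) (d * dim_col A)
     (\<lambda>(i,j). if i div dim_row A = j div dim_col A
              then A $$ (i mod dim_row A, j mod dim_col A) else 0)"

fun block_diag :: "complex mat list \<Rightarrow> complex mat" where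
  "block_diag [] = 0\<^sub>m 0 0"
| "block_diag (A # As) =
     (let B = block_diag As in
      four_block_mat A (0\<^sub>m (dim_row A) (dim_col B)) (0\<^sub>m (dim_row B) (dim_col A)) B)"

definition normalized_U1_2cocycle :: "('g, 'b) monoid_scheme \<Rightarrow> ('g \<Rightarrow> 'g \<Rightarrow> complex) \<Rightarrow> bool" where
  "normalized_U1_2cocycle G \<omega> \<longleftrightarrow>
     (\<forall>g\<in>carrier G. \<forall>h\<in>carrier G. cmod (\<omega> g h) = 1) \<and>
     (\<forall>g\<in>carrier G. \<forall>h\<in>carrier G. \<forall>k\<in>carrier G.
        \<omega> g h * \<omega> (g \<otimes>\<^bsub>G\<^esub> h) k = \<omega> h k * \<omega> g (h \<otimes>\<^bsub>G\<^esub> k)) \<and>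
     (\<forall>g\<in>carrier G. \<omega> \<one>\<^bsub>G\<^esub> g = 1 \<and> \<omega> g \<one>\<^bsub>G\<^esub> = 1)"

definition proj_unitary_rep ::
  "('g, 'b) monoid_scheme \<Rightarrow> ('g \<Rightarrow> 'g \<Rightarrow> complex) \<Rightarrow> nat \<Rightarrow> ('g \<Rightarrow> complex mat) \<Rightarrow> bool" where
  "proj_unitary_rep G \<omega> d \<rho> \<longleftrightarrow>
     (\<forall>g\<in>carrier G. unitary_mat d (\<rho> g)) \<and>
     (\<forall>g\<in>carrier G. \<forall>h\<in>carrier G. \<rho> g * \<rho> h = \<omega> g h \<cdot>\<^sub>m \<rho> (g \<otimes>\<^bsub>G\<^esub> h))"

definition subspace_vec :: "nat \<Rightarrow> complex vec set \<Rightarrow> bool" where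
  "subspace_vec d S \<longleftrightarrow> S \<subseteq> carrier_vec d \<and> 0\<^sub>v d \<in> S \<and>
     (\<forall>u\<in>S. \<forall>v\<in>S. u + v \<in> S) \<and> (\<forall>a. \<forall>v\<in>S. a \<cdot>\<^sub>v v \<in> S)"

definition irreducible_proj_rep ::
  "('g, 'b) monoid_scheme \<Rightarrow> ('g \<Rightarrow> 'g \<Rightarrow> complex) \<Rightarrow> nat \<Rightarrow> ('g \<Rightarrow> complex mat) \<Rightarrow> bool" where
  "irreducible_proj_rep G \<omega> d \<rho> \<longleftrightarrow> proj_unitary_rep G \<omega> d \<rho> \<and> d > 0 \<and>
     (\<forall>S. subspace_vec d S \<and> (\<forall>g\<in>carrier G. \<forall>v\<in>S. \<rho> g *\<^sub>v v \<in> S)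
          \<longrightarrow> S = {0\<^sub>v d} \<or> S = carrier_vec d)"

definition equiv_proj_rep ::
  "('g, 'b) monoid_scheme \<Rightarrow> nat \<Rightarrow> ('g \<Rightarrow> complex mat) \<Rightarrow> nat \<Rightarrow> ('g \<Rightarrow> complex mat) \<Rightarrow> bool" where
  "equiv_proj_rep G d \<rho> d' \<sigma> \<longleftrightarrow> d = d' \<and>
     (\<exists>T\<in>carrier_mat d d. invertible_mat T \<and> (\<forall>g\<in>carrier G. T * \<rho> g = \<sigma> g * T))"

definition complete_irrep_system ::
  "('g, 'b) monoid_scheme \<Rightarrow> ('g \<Rightarrow> 'g \<Rightarrow> complex) \<Rightarrow> nat list \<Rightarrow> ('g \<Rightarrow> complex mat) list \<Rightarrow> bool" where
  "complete_irrep_system G \<omega> ds reps \<longleftrightarrow> length ds = length reps \<and>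
     (\<forall>\<alpha><length ds. irreducible_proj_rep G \<omega> (ds ! \<alpha>) (reps ! \<alpha>)) \<and>
     (\<forall>\<alpha><length ds. \<forall>\<beta><length ds. \<alpha> \<noteq> \<beta> \<longrightarrow>
         \<not> equiv_proj_rep G (ds ! \<alpha>) (reps ! \<alpha>) (ds ! \<beta>) (reps ! \<beta>)) \<and>
     (\<forall>d \<rho>. irreducible_proj_rep G \<omega> d \<rho> \<longrightarrow>
         (\<exists>\<alpha><length ds. equiv_proj_rep G d \<rho> (ds ! \<alpha>) (reps ! \<alpha>)))"

definition std_complex_gaussian_density :: "complex \<Rightarrow> ennreal" where
  "std_complex_gaussian_density z = ennreal (exp (- (cmod z)\<^sup>2) / pi)"

text \<open>Rows are indexed by \<open>(L, g_l)\<close> encoded as \<open>L * n + a\<close> with \<open>g_l = e a\<close>;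
  columns by \<open>(g_r, R)\<close> encoded as \<open>b * dR + R\<close> with \<open>g_r = e b\<close>;
  here \<open>e\<close> enumerates the group, \<open>n = |G|\<close>, and \<open>L, R\<close> are 0-based.\<close>
definition W_mat ::
  "('g, 'b) monoid_scheme \<Rightarrow> (nat \<Rightarrow> 'g) \<Rightarrow> ('g \<Rightarrow> 'g \<Rightarrow> complex) \<Rightarrow> nat \<Rightarrow> nat
    \<Rightarrow> (nat \<Rightarrow> 'g \<Rightarrow> nat \<Rightarrow> complex) \<Rightarrow> complex mat" where
  "W_mat G e \<omega> dL dR c =
     (let n = card (carrier G) in
      mat (dL * n) (n * dR) (\<lambda>(i,j).
        let L = i div n; gl = e (i mod n); gr = e (j div dR); R = j mod dR;
            h = inv\<^bsub>G\<^esub> gr \<otimes>\<^bsub>G\<^esub> gl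
        in complex_of_real (1 / sqrt (real n)) * \<omega> gr h * c L h R))"

end

theory Submission
  imports Defs "Jordan_Normal_Form.Spectral_Radius"
begin

text \<open>
  Up to the factor \<open>1 / sqrt |G|\<close>, the matrix \<open>W\<close> is the sum over \<open>h\<close> of \<open>c L h R\<close> times the twisted
  right translation by \<open>h\<close>. The functions \<open>sqrt (d / |G|) * \<rho>(g)\<^sub>i\<^sub>j\<close>, with \<open>\<rho>\<close> running through the irreducible
  projective representations, form an orthonormal basis of the functions on \<open>G\<close> (Schur orthogonality
  and Peter-Weyl), and in this basis right translation by \<open>h\<close> acts on each row \<open>i\<close> of coefficients
  by \<open>\<rho>(h)\<close>. This block diagonalises \<open>W\<close>; the entries of the blocks are the coefficients of the
  functions \<open>h \<mapsto> c L h R\<close> in the same basis. So they arise from the family \<open>c\<close> by a unitary map,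
  and the standard complex Gaussian product measure is invariant under unitary maps.
\<close>

section \<open>Complex matrices and isometries\<close>

text \<open>Schur orthogonality alone yields orthonormality. That the two transforms are square, and
  that the blocks have as many entries as there are variables, rests on the count: the squares of
  the dimensions add up to |G|. Spanning is proved by contradiction: the orthogonal complement of
  all coefficients is invariant under the twisted regular representation, and an irreducible piece
  of it would consist of functions orthogonal to themselves.

  The obstacle throughout is the phase \<omega>. Products of representation matrices with adjoints
  are arranged so that the same phase appears on both sides of an average, and the phase in the
  entries of W is the one that makes right translation act linearly on coefficients.

  The entries of all blocks are treated as the image of \<open>c\<close> under one unitary map, so
  independence inside a block and between blocks is a single statement. Its effect on the Gaussian
  law is derived from translation invariance of Lebesgue measure.\<close>

lemma mat_mult_entry:
  assumes "A \<in> carrier_mat n m" "B \<in> carrier_mat m k" "i < n" "j < k"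
  shows "(A * B) $$ (i,j) = (\<Sum>l<m. A $$ (i,l) * B $$ (l,j))"
  using assms by (auto simp: scalar_prod_def atLeast0LessThan intro!: sum.cong)

lemma mat_vec_entry:
  assumes "A \<in> carrier_mat n m" "v \<in> carrier_vec m" "i < n"
  shows "(A *\<^sub>v v) $ i = (\<Sum>l<m. A $$ (i,l) * v $ l)"
  using assms by (auto simp: scalar_prod_def atLeast0LessThan intro!: sum.cong)

lemma cadj_carrier [simp]: "A \<in> carrier_mat n m \<Longrightarrow> cadj A \<in> carrier_mat m n"
  by (auto simp: cadj_def)

lemma dim_row_cadj [simp]: "dim_row (cadj A) = dim_col A"
  and dim_col_cadj [simp]: "dim_col (cadj A) = dim_row A"
  by (auto simp: cadj_def)

lemma cadj_index: "i < dim_col A \<Longrightarrow> j < dim_row A \<Longrightarrow> cadj A $$ (i,j) = cnj (A $$ (j,i))"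
  by (auto simp: cadj_def)

lemma cadj_mult:
  assumes "A \<in> carrier_mat n m" "B \<in> carrier_mat m k"
  shows "cadj (A * B) = cadj B * cadj A"
proof (rule eq_matI)
  fix i j assume "i < dim_row (cadj B * cadj A)" "j < dim_col (cadj B * cadj A)"
  then have ij: "i < k" "j < n" using assms by auto
  have "cadj (A * B) $$ (i,j) = cnj (\<Sum>l<m. A $$ (j,l) * B $$ (l,i))"
    using ij assms mat_mult_entry[OF assms, of j i] by (simp add: cadj_def del: index_mult_mat(1))
  also have "\<dots> = (cadj B * cadj A) $$ (i,j)"
    using ij assms by (subst mat_mult_entry[of _ k m _ n])
      (auto simp: cadj_index mult.commute intro!: sum.cong)
  finally show "cadj (A * B) $$ (i,j) = (cadj B * cadj A) $$ (i,j)" .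
qed (use assms in auto)

text \<open>If n < k, padding both factors with zeros makes them square without changing
  \<open>A * B\<close>, so the product in the other order is the identity too; but it has a zero at
  (n, n). Equality of dimensions in Schur's lemma and the dimension count both rest on this.\<close>

lemma left_inverse_dim_le:
  fixes A B :: "complex mat"
  assumes A: "A \<in> carrier_mat k n" and B: "B \<in> carrier_mat n k" and AB: "A * B = 1\<^sub>m k"
  shows "k \<le> n"
proof (rule ccontr)
  assume "\<not> k \<le> n"
  then have nk: "n < k" by simp
  define A' where "A' = mat k k (\<lambda>(i,j). if j < n then A $$ (i,j) else 0)"
  define B' where "B' = mat k k (\<lambda>(i,j). if i < n then B $$ (i,j) else 0)"
  have A': "A' \<in> carrier_mat k k" and B': "B' \<in> carrier_mat k k"
    by (auto simp: A'_def B'_def)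
  have "A' * B' = 1\<^sub>m k"
  proof (rule eq_matI)
    fix i j assume ij: "i < dim_row (1\<^sub>m k :: complex mat)" "j < dim_col (1\<^sub>m k :: complex mat)"
    then have "(A' * B') $$ (i,j) = (\<Sum>l<k. if l < n then A $$ (i,l) * B $$ (l,j) else 0)"
      by (subst mat_mult_entry[OF A' B']) (auto simp: A'_def B'_def intro!: sum.cong)
    also have "\<dots> = (\<Sum>l<n. A $$ (i,l) * B $$ (l,j))"
      using nk by (intro sum.mono_neutral_cong_right) auto
    also have "\<dots> = (A * B) $$ (i,j)"
      using ij by (subst mat_mult_entry[OF A B]) auto
    finally show "(A' * B') $$ (i,j) = (1\<^sub>m k) $$ (i,j)" using AB by simp
  qed (use A' B' in auto)
  then have "B' * A' = 1\<^sub>m k"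
    using mat_mult_left_right_inverse[OF A' B'] by simp
  moreover have "(B' * A') $$ (n,n) = 0"
    using nk by (subst mat_mult_entry[OF B' A']) (auto simp: B'_def)
  ultimately show False using nk by simp
qed

lemma subspace_vec_diff:
  assumes "subspace_vec n S" "u \<in> S" "v \<in> S"
  shows "u - v \<in> S"
proof -
  have "u \<in> carrier_vec n" "v \<in> carrier_vec n"
    using assms by (auto simp: subspace_vec_def)
  then have "u - v = u + (-1) \<cdot>\<^sub>v v" by (intro eq_vecI) auto
  then show ?thesis using assms by (auto simp: subspace_vec_def)
qed

text \<open>One Gram-Schmidt step: u, orthogonal to the columns of V, is normalised and appended.
  The subspace S is carried along so that the range of the larger isometry stays inside it.\<close>

lemma extend_isometry:
  assumes V: "V \<in> carrier_mat n k" and iso: "cadj V * V = 1\<^sub>m k"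
    and u: "u \<in> carrier_vec n" "u \<noteq> 0\<^sub>v n" and orth: "cadj V *\<^sub>v u = 0\<^sub>v k"
    and S: "subspace_vec n S" "u \<in> S" "\<And>w. w \<in> carrier_vec k \<Longrightarrow> V *\<^sub>v w \<in> S"
  shows "\<exists>V'. V' \<in> carrier_mat n (Suc k) \<and> cadj V' * V' = 1\<^sub>m (Suc k)
    \<and> (\<forall>w\<in>carrier_vec (Suc k). V' *\<^sub>v w \<in> S)"
proof -
  define s where "s = (\<Sum>i<n. (cmod (u $ i))\<^sup>2)"
  obtain i0 where "i0 < n" "u $ i0 \<noteq> 0" using u by (metis eq_vecI carrier_vecD index_zero_vec)
  then have s: "s > 0" unfolding s_def by (intro sum_pos2[of _ i0]) auto
  define t where "t = complex_of_real (1 / sqrt s)"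
  define V' where "V' = mat n (Suc k) (\<lambda>(i,j). if j < k then V $$ (i,j) else t * u $ i)"
  have V': "V' \<in> carrier_mat n (Suc k)" by (simp add: V'_def)
  have VV: "(\<Sum>i<n. cnj (V $$ (i,a)) * V $$ (i,b)) = (if a = b then 1 else 0)" if "a < k" "b < k" for a b
  proof -
    have "(\<Sum>i<n. cnj (V $$ (i,a)) * V $$ (i,b)) = (cadj V * V) $$ (a,b)"
      using V that by (subst mat_mult_entry[of _ k n _ k]) (auto simp: cadj_index)
    then show ?thesis using that iso by simp
  qed
  have Vu: "(\<Sum>i<n. cnj (V $$ (i,a)) * u $ i) = 0" if "a < k" for a
  proof -
    have "(\<Sum>i<n. cnj (V $$ (i,a)) * u $ i) = (cadj V *\<^sub>v u) $ a"
      using V u that by (subst mat_vec_entry[of _ k n]) (auto simp: cadj_index)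
    then show ?thesis using that orth by simp
  qed
  have uV: "(\<Sum>i<n. cnj (u $ i) * V $$ (i,a)) = 0" if "a < k" for a
    using arg_cong[OF Vu[OF that], of cnj] by (simp add: mult.commute)
  have uu: "(\<Sum>i<n. cnj (u $ i) * u $ i) = of_real s"
    unfolding s_def by (simp add: complex_norm_square mult.commute del: of_real_power)
  have tt: "cnj t * t * of_real s = 1"
    using s by (simp add: t_def flip: of_real_mult)
  have "cadj V' * V' = 1\<^sub>m (Suc k)"
  proof (rule eq_matI)
    fix a b assume "a < dim_row (1\<^sub>m (Suc k) :: complex mat)" "b < dim_col (1\<^sub>m (Suc k) :: complex mat)"
    then have ab: "a < Suc k" "b < Suc k" by auto
    have "(cadj V' * V') $$ (a,b) = (\<Sum>i<n. cnj (V' $$ (i,a)) * V' $$ (i,b))"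
      using V' ab by (subst mat_mult_entry[of _ "Suc k" n _ "Suc k"]) (auto simp: cadj_index)
    also have "\<dots> = (if a = b then 1 else 0)"
    proof (cases "a < k"; cases "b < k")
      assume "a < k" "b < k"
      then show ?thesis using VV[of a b] by (simp add: V'_def)
    next
      assume "a < k" "\<not> b < k"
      then have "(\<Sum>i<n. cnj (V' $$ (i,a)) * V' $$ (i,b)) = t * (\<Sum>i<n. cnj (V $$ (i,a)) * u $ i)"
        using ab by (auto simp: V'_def sum_distrib_left algebra_simps intro!: sum.cong)
      then show ?thesis using \<open>a < k\<close> \<open>\<not> b < k\<close> Vu by simp
    next
      assume "\<not> a < k" "b < k"
      then have "(\<Sum>i<n. cnj (V' $$ (i,a)) * V' $$ (i,b)) = cnj t * (\<Sum>i<n. cnj (u $ i) * V $$ (i,b))"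
        using ab by (auto simp: V'_def sum_distrib_left algebra_simps intro!: sum.cong)
      then show ?thesis using \<open>\<not> a < k\<close> \<open>b < k\<close> uV by simp
    next
      assume "\<not> a < k" "\<not> b < k"
      then have "(\<Sum>i<n. cnj (V' $$ (i,a)) * V' $$ (i,b)) = cnj t * t * (\<Sum>i<n. cnj (u $ i) * u $ i)"
        using ab by (auto simp: V'_def sum_distrib_left algebra_simps intro!: sum.cong)
      then show ?thesis using \<open>\<not> a < k\<close> \<open>\<not> b < k\<close> ab uu tt by simp
    qed
    finally show "(cadj V' * V') $$ (a,b) = 1\<^sub>m (Suc k) $$ (a,b)" using ab by simp
  qed (use V' in auto)
  moreover have "V' *\<^sub>v w \<in> S" if w: "w \<in> carrier_vec (Suc k)" for w
  proof -
    have w': "vec k (\<lambda>i. w $ i) \<in> carrier_vec k" by simp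
    have "V' *\<^sub>v w = V *\<^sub>v vec k (\<lambda>i. w $ i) + (t * w $ k) \<cdot>\<^sub>v u"
    proof (rule eq_vecI)
      fix i assume "i < dim_vec (V *\<^sub>v vec k (\<lambda>i. w $ i) + (t * w $ k) \<cdot>\<^sub>v u)"
      then have i: "i < n" using u by simp
      show "(V' *\<^sub>v w) $ i = (V *\<^sub>v vec k (\<lambda>i. w $ i) + (t * w $ k) \<cdot>\<^sub>v u) $ i"
        using i u V mat_vec_entry[OF V' w i] mat_vec_entry[OF V w' i]
        by (auto simp: V'_def simp del: index_mult_mat_vec)
    qed (use V' V u in auto)
    then show ?thesis using S w' by (auto simp: subspace_vec_def)
  qed
  ultimately show ?thesis using V' by blast
qed

text \<open>Among isometries with range in S, one with the most columns must reach all of S: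
  otherwise the residue \<open>v - V *\<^sub>v (cadj V *\<^sub>v v)\<close> of some v in S would
  supply a further column. Encoding S by V makes a subrepresentation a family of k by k matrices
  again.\<close>

lemma subspace_isometry:
  assumes S: "subspace_vec n S"
  shows "\<exists>k V. V \<in> carrier_mat n k \<and> k \<le> n \<and> cadj V * V = 1\<^sub>m k
    \<and> (\<forall>w\<in>carrier_vec k. V *\<^sub>v w \<in> S) \<and> (\<forall>v\<in>S. V *\<^sub>v (cadj V *\<^sub>v v) = v)"
proof -
  define P where "P k V \<longleftrightarrow> V \<in> carrier_mat n k \<and> cadj V * V = 1\<^sub>m k
    \<and> (\<forall>w\<in>carrier_vec k. V *\<^sub>v w \<in> S)" for k V
  have bound: "k \<le> n" if "P k V" for k V
    using that left_inverse_dim_le[of "cadj V" k n V] by (auto simp: P_def)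
  have "P 0 (0\<^sub>m n 0)"
  proof -
    have "(0\<^sub>m n 0 :: complex mat) *\<^sub>v w = 0\<^sub>v n" if "w \<in> carrier_vec 0" for w
      using that by (intro eq_vecI) (auto simp: scalar_prod_def)
    then show ?thesis using S unfolding P_def
      by (auto simp: subspace_vec_def intro!: eq_matI)
  qed
  then have "\<exists>k. \<exists>V. P k V" by blast
  moreover have "\<forall>k. (\<exists>V. P k V) \<longrightarrow> k \<le> n" using bound by blast
  ultimately obtain k where k: "\<exists>V. P k V" "\<forall>j. (\<exists>V. P j V) \<longrightarrow> j \<le> k"
    using Greatest_le_nat[of "\<lambda>k. \<exists>V. P k V" _ n] GreatestI_nat[of "\<lambda>k. \<exists>V. P k V" _ n] by metis
  then obtain V where V: "P k V" by blast
  have Vc: "V \<in> carrier_mat n k" and iso: "cadj V * V = 1\<^sub>m k"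
    and VS: "\<And>w. w \<in> carrier_vec k \<Longrightarrow> V *\<^sub>v w \<in> S" using V by (auto simp: P_def)
  have "V *\<^sub>v (cadj V *\<^sub>v v) = v" if v: "v \<in> S" for v
  proof (rule ccontr)
    assume ne: "V *\<^sub>v (cadj V *\<^sub>v v) \<noteq> v"
    have vc: "v \<in> carrier_vec n" using v S by (auto simp: subspace_vec_def)
    define u where "u = v - V *\<^sub>v (cadj V *\<^sub>v v)"
    have cv: "cadj V *\<^sub>v v \<in> carrier_vec k" using Vc vc by (metis cadj_carrier mult_mat_vec_carrier)
    have VVv: "V *\<^sub>v (cadj V *\<^sub>v v) \<in> carrier_vec n" using Vc cv by auto
    have uc: "u \<in> carrier_vec n" using VVv vc by (auto simp: u_def)
    have uS: "u \<in> S" unfolding u_def by (rule subspace_vec_diff[OF S v VS[OF cv]])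
    have "u \<noteq> 0\<^sub>v n"
    proof
      assume u0: "u = 0\<^sub>v n"
      have "V *\<^sub>v (cadj V *\<^sub>v v) = v"
      proof (rule eq_vecI)
        fix i assume i: "i < dim_vec v"
        then have "u $ i = v $ i - (V *\<^sub>v (cadj V *\<^sub>v v)) $ i"
          using vc VVv Vc unfolding u_def by (auto simp del: index_mult_mat_vec)
        then show "(V *\<^sub>v (cadj V *\<^sub>v v)) $ i = v $ i"
          using u0 i vc by (auto simp del: index_mult_mat_vec)
      qed (use Vc vc in auto)
      then show False using ne by simp
    qed
    moreover have "cadj V *\<^sub>v u = 0\<^sub>v k"
    proof -
      have "cadj V *\<^sub>v u = cadj V *\<^sub>v v - cadj V *\<^sub>v (V *\<^sub>v (cadj V *\<^sub>v v))"
        unfolding u_def by (rule mult_minus_distrib_mat_vec[of _ k n]) (use Vc VVv vc in auto)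
      also have "cadj V *\<^sub>v (V *\<^sub>v (cadj V *\<^sub>v v)) = cadj V *\<^sub>v v"
        using Vc cv iso by (simp flip: assoc_mult_mat_vec[of _ k n _ k])
      finally show ?thesis using cv by auto
    qed
    ultimately have "\<exists>V'. P (Suc k) V'"
      using extend_isometry[OF Vc iso uc _ _ S uS VS] by (auto simp: P_def)
    then show False using k by (metis Suc_n_not_le_n)
  qed
  then show ?thesis using Vc iso VS bound[OF V] by blast
qed

lemma cadj_smult: "cadj (c \<cdot>\<^sub>m A) = cnj c \<cdot>\<^sub>m cadj A"
  by (rule eq_matI) (auto simp: cadj_def)

section \<open>Block diagonal and Kronecker matrices\<close>

lemma sum_div_mod:
  fixes f :: "nat \<Rightarrow> 'a::comm_monoid_add"
  shows "(\<Sum>y<m * n. f y) = (\<Sum>a<m. \<Sum>b<n. f (a * n + b))"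
proof (induction m)
  case (Suc m)
  have "(\<Sum>y<Suc m * n. f y) = (\<Sum>y<m * n. f y) + (\<Sum>y\<in>{m * n..<m * n + n}. f y)"
    by (subst sum.union_disjoint[symmetric]) (auto intro!: sum.cong)
  also have "(\<Sum>y\<in>{m * n..<m * n + n}. f y) = (\<Sum>b<n. f (m * n + b))"
    by (rule sum.reindex_bij_witness[of _ "\<lambda>b. m * n + b" "\<lambda>y. y - m * n"]) auto
  finally show ?case using Suc by simp
qed simp

lemma div_less_of_less_mult: "(i::nat) < a * b \<Longrightarrow> i div b < a"
  by (simp add: less_mult_imp_div_less)

lemma mod_less_of_less_mult: "(i::nat) < a * b \<Longrightarrow> i mod b < b"
  by (cases "b = 0") auto

lemma pair_less: "(a::nat) < p \<Longrightarrow> b < q \<Longrightarrow> a * q + b < p * q"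
proof -
  assume "a < p" "b < q"
  then have "a * q + b < Suc a * q" "Suc a * q \<le> p * q" by (simp_all only: mult_le_mono1 Suc_leI, simp)
  then show ?thesis by linarith
qed

text \<open>Gives access to single entries of the recursively built \<open>block_diag\<close>. Rows
  and columns are located by separate size lists, because the blocks are rectangular in
  general.\<close>

fun block_pos :: "nat list \<Rightarrow> nat \<Rightarrow> nat \<times> nat" where
  "block_pos [] r = (0, r)"
| "block_pos (s # ss) r = (if r < s then (0, r) else (Suc (fst (block_pos ss (r - s))), snd (block_pos ss (r - s))))"

lemma block_pos_range:
  "r < sum_list ss \<Longrightarrow> fst (block_pos ss r) < length ss \<and> snd (block_pos ss r) < ss ! fst (block_pos ss r)"
  by (induction ss arbitrary: r) auto

lemma block_pos_inj:
  "r < sum_list ss \<Longrightarrow> r' < sum_list ss \<Longrightarrow> block_pos ss r = block_pos ss r' \<longleftrightarrow> r = r'"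
proof (induction ss arbitrary: r r')
  case (Cons s ss)
  show ?case
  proof (cases "r < s \<or> r' < s")
    case False
    then have "block_pos ss (r - s) = block_pos ss (r' - s) \<longleftrightarrow> r - s = r' - s"
      using Cons.prems by (intro Cons.IH) auto
    then show ?thesis using False by (auto simp: prod_eq_iff)
  qed auto
qed simp

lemma dim_block_diag [simp]:
  "dim_row (block_diag As) = sum_list (map dim_row As)"
  "dim_col (block_diag As) = sum_list (map dim_col As)"
  by (induction As) (auto simp: Let_def)

lemma block_diag_index:
  assumes "r < sum_list (map dim_row As)" "c < sum_list (map dim_col As)"
  shows "block_diag As $$ (r,c) =
    (let (k,i) = block_pos (map dim_row As) r; (l,j) = block_pos (map dim_col As) c
     in if k = l then (As ! k) $$ (i,j) else 0)"
  using assms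
proof (induction As arbitrary: r c)
  case (Cons A As)
  show ?case
  proof (cases "r < dim_row A \<or> c < dim_col A")
    case True
    then show ?thesis using Cons.prems by (auto simp: Let_def)
  next
    case False
    then have "r - dim_row A < sum_list (map dim_row As)" "c - dim_col A < sum_list (map dim_col As)"
      using Cons.prems by auto
    from Cons.IH[OF this] show ?thesis using False Cons.prems
      by (auto simp: Let_def split: prod.splits)
  qed
qed simp

lemma cadj_block_diag: "cadj (block_diag As) = block_diag (map cadj As)"
proof (induction As)
  case Nil
  show ?case by (rule eq_matI) auto
next
  case (Cons A As)
  show ?case
    unfolding list.map block_diag.simps Let_def Cons[symmetric]
    by (rule eq_matI) (auto simp: cadj_def)
qed

lemma block_diag_mult:
  assumes "\<And>A B. (A, B) \<in> set (zip As Bs) \<Longrightarrow> dim_col A = dim_row B" and "length As = length Bs"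
  shows "block_diag As * block_diag Bs = block_diag (map2 (*) As Bs)"
  using assms(2,1)
proof (induction As Bs rule: list_induct2)
  case Nil
  show ?case by (rule eq_matI) auto
next
  case (Cons A As B Bs)
  have IH: "block_diag As * block_diag Bs = block_diag (map2 (*) As Bs)" using Cons by auto
  have dimAB: "dim_col A = dim_row B" using Cons.prems by auto
  let ?P = "block_diag As" and ?Q = "block_diag Bs"
  \<comment> \<open>Blocks match one by one, hence the tails are conformable as whole
    matrices.\<close>
  have rel: "map dim_col As = map dim_row Bs"
    using Cons.prems Cons.hyps by (intro nth_equalityI) (auto simp: set_zip)
  then have PQ: "dim_col ?P = dim_row ?Q" by simp
  have "block_diag (A # As) * block_diag (B # Bs)
      = four_block_mat A (0\<^sub>m (dim_row A) (dim_col ?P)) (0\<^sub>m (dim_row ?P) (dim_col A)) ?P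
        * four_block_mat B (0\<^sub>m (dim_row B) (dim_col ?Q)) (0\<^sub>m (dim_row ?Q) (dim_col B)) ?Q"
    by (simp add: Let_def)
  also have "\<dots> = four_block_mat (A * B) (0\<^sub>m (dim_row A) (dim_col ?Q)) (0\<^sub>m (dim_row ?P) (dim_col B)) (?P * ?Q)"
  proof (subst mult_four_block_mat[of _ "dim_row A" "dim_col A" _ "dim_col ?P" _ "dim_row ?P" _ _ "dim_col B" _ "dim_col ?Q"])
  qed (use dimAB PQ in \<open>auto simp del: dim_block_diag intro!: arg_cong4[of _ _ _ _ _ _ _ _ four_block_mat]\<close>)
  also have "\<dots> = block_diag (map2 (*) (A # As) (B # Bs))"
    by (simp add: Let_def IH[symmetric] del: dim_block_diag)
  finally show ?case .
qed

lemma dim_kron_id [simp]: "dim_row (kron_id d A) = d * dim_row A" "dim_col (kron_id d A) = d * dim_col A"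
  by (auto simp: kron_id_def)

lemma cadj_kron_id: "cadj (kron_id d A) = kron_id d (cadj A)"
  by (rule eq_matI)
    (auto simp: cadj_def kron_id_def div_less_of_less_mult mod_less_of_less_mult)

lemma kron_id_mult:
  assumes A: "A \<in> carrier_mat p q" and B: "B \<in> carrier_mat q r"
  shows "kron_id d A * kron_id d B = kron_id d (A * B)"
proof (rule eq_matI)
  fix i j assume "i < dim_row (kron_id d (A * B))" "j < dim_col (kron_id d (A * B))"
  then have i: "i < d * p" and j: "j < d * r" using A B by auto
  note ij = div_less_of_less_mult[OF i] mod_less_of_less_mult[OF i]
    div_less_of_less_mult[OF j] mod_less_of_less_mult[OF j]
  have KA: "kron_id d A \<in> carrier_mat (d * p) (d * q)" and KB: "kron_id d B \<in> carrier_mat (d * q) (d * r)"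
    using A B by (auto simp: kron_id_def)
  have "(kron_id d A * kron_id d B) $$ (i,j) = (\<Sum>y<d * q. kron_id d A $$ (i,y) * kron_id d B $$ (y,j))"
    by (rule mat_mult_entry[OF KA KB i j])
  also have "\<dots> = (\<Sum>a<d. \<Sum>b<q. kron_id d A $$ (i,a * q + b) * kron_id d B $$ (a * q + b,j))"
    by (rule sum_div_mod)
  \<comment> \<open>The inner index splits into copy a and position b. The identity factor keeps
    only the copy containing row i, which must also be the copy of column j.\<close>
  also have "\<dots> = (\<Sum>a<d. if a = i div p then (if i div p = j div r then
      (\<Sum>b<q. A $$ (i mod p, b) * B $$ (b, j mod r)) else 0) else 0)"
  proof (rule sum.cong[OF refl])
    fix a assume a: "a \<in> {..<d}"
    have "kron_id d A $$ (i,a * q + b) * kron_id d B $$ (a * q + b,j) =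
      (if a = i div p \<and> i div p = j div r then A $$ (i mod p, b) * B $$ (b, j mod r) else 0)" if b: "b < q" for b
    proof -
      have "a * q + b < Suc a * q" using b by simp
      also have "\<dots> \<le> d * q" using a by (intro mult_le_mono1) auto
      finally have "a * q + b < d * q" .
      then show ?thesis using A B i j b by (auto simp: kron_id_def)
    qed
    then show "(\<Sum>b<q. kron_id d A $$ (i,a * q + b) * kron_id d B $$ (a * q + b,j)) =
      (if a = i div p then (if i div p = j div r then
      (\<Sum>b<q. A $$ (i mod p, b) * B $$ (b, j mod r)) else 0) else 0)"
      by simp
  qed
  also have "\<dots> = (if i div p = j div r then (\<Sum>b<q. A $$ (i mod p, b) * B $$ (b, j mod r)) else 0)"
    using ij by simp
  also have "\<dots> = kron_id d (A * B) $$ (i,j)"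
    using A B i j ij mat_mult_entry[OF A B ij(2,4)] by (simp add: kron_id_def del: index_mult_mat(1))
  finally show "(kron_id d A * kron_id d B) $$ (i,j) = kron_id d (A * B) $$ (i,j)" .
qed (use A B in auto)

section \<open>Schur orthogonality for projective representations\<close>

locale finite_group_cocycle = group G for G (structure) +
  fixes \<omega> :: "'a \<Rightarrow> 'a \<Rightarrow> complex"
  assumes finite_G: "finite (carrier G)"
    and cocycle: "normalized_U1_2cocycle G \<omega>"
begin

lemma norm_cocycle: "g \<in> carrier G \<Longrightarrow> h \<in> carrier G \<Longrightarrow> cnj (\<omega> g h) * \<omega> g h = 1"
  using cocycle by (simp add: normalized_U1_2cocycle_def mult.commute flip: complex_norm_square)

lemma cocycle_assoc:
  "g \<in> carrier G \<Longrightarrow> h \<in> carrier G \<Longrightarrow> k \<in> carrier G \<Longrightarrow>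
    \<omega> g h * \<omega> (g \<otimes> h) k = \<omega> h k * \<omega> g (h \<otimes> k)"
  using cocycle by (simp add: normalized_U1_2cocycle_def)

lemma cocycle_one: "g \<in> carrier G \<Longrightarrow> \<omega> \<one> g = 1"
  using cocycle by (simp add: normalized_U1_2cocycle_def)

lemma sum_translate:
  fixes f :: "'a \<Rightarrow> 'c::comm_monoid_add"
  assumes "h \<in> carrier G"
  shows "(\<Sum>g\<in>carrier G. f g) = (\<Sum>g\<in>carrier G. f (h \<otimes> g))"
proof (rule sum.reindex_bij_witness[of _ "\<lambda>g. h \<otimes> g" "\<lambda>g. inv h \<otimes> g"])
  fix a assume a: "a \<in> carrier G"
  show "h \<otimes> (inv h \<otimes> a) = a" "inv h \<otimes> (h \<otimes> a) = a"
    using assms a by (simp_all flip: m_assoc)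
qed (use assms in \<open>auto simp flip: m_assoc\<close>)

lemma rep_carrier: "proj_unitary_rep G \<omega> d \<rho> \<Longrightarrow> g \<in> carrier G \<Longrightarrow> \<rho> g \<in> carrier_mat d d"
  by (simp add: proj_unitary_rep_def unitary_mat_def)

lemma rep_adj_mult: "proj_unitary_rep G \<omega> d \<rho> \<Longrightarrow> g \<in> carrier G \<Longrightarrow> cadj (\<rho> g) * \<rho> g = 1\<^sub>m d"
  by (simp add: proj_unitary_rep_def unitary_mat_def)

lemma rep_mult:
  "proj_unitary_rep G \<omega> d \<rho> \<Longrightarrow> g \<in> carrier G \<Longrightarrow> h \<in> carrier G \<Longrightarrow>
    \<rho> g * \<rho> h = \<omega> g h \<cdot>\<^sub>m \<rho> (g \<otimes> h)"
  by (simp add: proj_unitary_rep_def)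

lemma rep_mult_entry:
  assumes "proj_unitary_rep G \<omega> d \<rho>" "g \<in> carrier G" "h \<in> carrier G" "i < d" "j < d"
  shows "(\<Sum>m<d. \<rho> g $$ (i,m) * \<rho> h $$ (m,j)) = \<omega> g h * \<rho> (g \<otimes> h) $$ (i,j)"
proof -
  have "(\<Sum>m<d. \<rho> g $$ (i,m) * \<rho> h $$ (m,j)) = (\<rho> g * \<rho> h) $$ (i,j)"
    using assms by (simp add: mat_mult_entry[OF rep_carrier rep_carrier] del: index_mult_mat(1))
  then show ?thesis
    using assms rep_carrier[of d \<rho> "g \<otimes> h"] by (auto simp: rep_mult simp del: index_mult_mat(1))
qed

lemma rep_column_orthonormal:
  assumes "proj_unitary_rep G \<omega> d \<rho>" "g \<in> carrier G" "k < d" "l < d"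
  shows "(\<Sum>m<d. cnj (\<rho> g $$ (m,k)) * \<rho> g $$ (m,l)) = (if k = l then 1 else 0)"
proof -
  have c: "\<rho> g \<in> carrier_mat d d" by (rule rep_carrier[OF assms(1,2)])
  have "(\<Sum>m<d. cnj (\<rho> g $$ (m,k)) * \<rho> g $$ (m,l)) = (cadj (\<rho> g) * \<rho> g) $$ (k,l)"
    using c assms by (subst mat_mult_entry[of _ d d _ d]) (auto simp: cadj_index)
  then show ?thesis using assms by (simp add: rep_adj_mult)
qed

text \<open>Entrywise form of \<open>cadj (\<rho> (h \<otimes> g)) * \<rho> h = \<omega> h g
  \<cdot>\<^sub>m cadj (\<rho> g)\<close>. Adjoints are used because \<open>\<rho> (inv h)\<close>
  agrees with \<open>cadj (\<rho> h)\<close> only up to a phase.\<close>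

lemma rep_adj_mult_entry:
  assumes "proj_unitary_rep G \<omega> d \<rho>" "g \<in> carrier G" "h \<in> carrier G" "k < d" "l < d"
  shows "(\<Sum>m<d. cnj (\<rho> (h \<otimes> g) $$ (m,l)) * \<rho> h $$ (m,k)) = \<omega> h g * cnj (\<rho> g $$ (k,l))"
proof -
  have "(\<Sum>m<d. cnj (\<rho> h $$ (m,k)) * (\<omega> h g * \<rho> (h \<otimes> g) $$ (m,l)))
      = (\<Sum>m<d. cnj (\<rho> h $$ (m,k)) * (\<Sum>j<d. \<rho> h $$ (m,j) * \<rho> g $$ (j,l)))"
    using assms by (simp add: rep_mult_entry)
  also have "\<dots> = (\<Sum>j<d. (\<Sum>m<d. cnj (\<rho> h $$ (m,k)) * \<rho> h $$ (m,j)) * \<rho> g $$ (j,l))"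
    by (simp add: sum_distrib_left sum_distrib_right mult.assoc, rule sum.swap)
  also have "\<dots> = (\<Sum>j<d. if k = j then \<rho> g $$ (j,l) else 0)"
    using assms by (intro sum.cong) (auto simp: rep_column_orthonormal)
  also have "\<dots> = \<rho> g $$ (k,l)" using assms by simp
  finally have "cnj (\<omega> h g) * (\<omega> h g * (\<Sum>m<d. cnj (\<rho> h $$ (m,k)) * \<rho> (h \<otimes> g) $$ (m,l)))
      = cnj (\<omega> h g) * \<rho> g $$ (k,l)"
    by (simp add: sum_distrib_left mult.left_commute)
  then have "(\<Sum>m<d. cnj (\<rho> h $$ (m,k)) * \<rho> (h \<otimes> g) $$ (m,l)) = cnj (\<omega> h g) * \<rho> g $$ (k,l)"
    using norm_cocycle[OF assms(3,2)] by (simp flip: mult.assoc)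
  from arg_cong[OF this, of cnj] show ?thesis by (simp add: mult.commute)
qed

text \<open>The mirror image, from \<open>\<rho> h * cadj (\<rho> (g \<otimes> h)) = \<omega> g h
  \<cdot>\<^sub>m cadj (\<rho> g)\<close>. It expresses a conjugate coefficient at g through those
  of the same row i at \<open>g \<otimes> h\<close>, which will make the orthogonal complement of
  the coefficients stable under right translation.\<close>

lemma rep_mult_adj_entry:
  assumes "proj_unitary_rep G \<omega> d \<rho>" "g \<in> carrier G" "h \<in> carrier G" "i < d" "j < d"
  shows "(\<Sum>m<d. \<rho> h $$ (j,m) * cnj (\<rho> (g \<otimes> h) $$ (i,m))) = \<omega> g h * cnj (\<rho> g $$ (i,j))"
proof -
  have c: "\<rho> h \<in> carrier_mat d d" by (rule rep_carrier[OF assms(1,3)])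
  have row: "(\<Sum>m<d. \<rho> h $$ (l,m) * cnj (\<rho> h $$ (j,m))) = (if l = j then 1 else 0)" if "l < d" for l
  proof -
    have "(\<Sum>m<d. \<rho> h $$ (l,m) * cnj (\<rho> h $$ (j,m))) = (\<rho> h * cadj (\<rho> h)) $$ (l,j)"
      using c assms that by (subst mat_mult_entry[of _ d d _ d]) (auto simp: cadj_index)
    then show ?thesis using assms that by (simp add: proj_unitary_rep_def unitary_mat_def)
  qed
  have "(\<Sum>m<d. (\<omega> g h * \<rho> (g \<otimes> h) $$ (i,m)) * cnj (\<rho> h $$ (j,m)))
      = (\<Sum>m<d. (\<Sum>l<d. \<rho> g $$ (i,l) * \<rho> h $$ (l,m)) * cnj (\<rho> h $$ (j,m)))"
    using assms by (simp add: rep_mult_entry)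
  also have "\<dots> = (\<Sum>l<d. \<rho> g $$ (i,l) * (\<Sum>m<d. \<rho> h $$ (l,m) * cnj (\<rho> h $$ (j,m))))"
    by (simp add: sum_distrib_left sum_distrib_right mult.assoc, rule sum.swap)
  also have "\<dots> = (\<Sum>l<d. if l = j then \<rho> g $$ (i,l) else 0)"
    by (intro sum.cong refl) (simp add: row)
  also have "\<dots> = \<rho> g $$ (i,j)" using assms by simp
  finally have "cnj (\<omega> g h) * (\<omega> g h * (\<Sum>m<d. \<rho> (g \<otimes> h) $$ (i,m) * cnj (\<rho> h $$ (j,m))))
      = cnj (\<omega> g h) * \<rho> g $$ (i,j)"
    by (simp add: sum_distrib_left mult.assoc)
  then have "(\<Sum>m<d. \<rho> (g \<otimes> h) $$ (i,m) * cnj (\<rho> h $$ (j,m))) = cnj (\<omega> g h) * \<rho> g $$ (i,j)"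
    using norm_cocycle[OF assms(2,3)] by (simp flip: mult.assoc)
  from arg_cong[OF this, of cnj] show ?thesis by (simp add: mult.commute)
qed

lemma sum_translate_right:
  fixes f :: "'a \<Rightarrow> 'c::comm_monoid_add"
  assumes "h \<in> carrier G"
  shows "(\<Sum>g\<in>carrier G. f (g \<otimes> h)) = (\<Sum>g\<in>carrier G. f g)"
proof (rule sum.reindex_bij_witness[of _ "\<lambda>g. g \<otimes> inv h" "\<lambda>g. g \<otimes> h"])
qed (use assms in \<open>auto simp: m_assoc\<close>)

section \<open>Schur's lemma\<close>

lemma irreducible_kernel_range:
  assumes \<rho>: "irreducible_proj_rep G \<omega> d \<rho>" and \<sigma>: "irreducible_proj_rep G \<omega> d' \<sigma>"
    and T: "T \<in> carrier_mat d d'" and inter: "\<And>g. g \<in> carrier G \<Longrightarrow> \<rho> g * T = T * \<sigma> g"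
    and nz: "T \<noteq> 0\<^sub>m d d'"
  shows "\<And>v. v \<in> carrier_vec d' \<Longrightarrow> T *\<^sub>v v = 0\<^sub>v d \<Longrightarrow> v = 0\<^sub>v d'"
    and "\<And>w. w \<in> carrier_vec d \<Longrightarrow> \<exists>v\<in>carrier_vec d'. T *\<^sub>v v = w"
proof -
  have r: "proj_unitary_rep G \<omega> d \<rho>" and s: "proj_unitary_rep G \<omega> d' \<sigma>"
    using \<rho> \<sigma> by (auto simp: irreducible_proj_rep_def)
  have swap: "\<rho> g *\<^sub>v (T *\<^sub>v v) = T *\<^sub>v (\<sigma> g *\<^sub>v v)" if "g \<in> carrier G" "v \<in> carrier_vec d'" for g v
    using assoc_mult_mat_vec[OF rep_carrier[OF r that(1)] T that(2)]
      assoc_mult_mat_vec[OF T rep_carrier[OF s that(1)] that(2)] inter[OF that(1)] by simp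
  \<comment> \<open>Some unit vector has nonzero image; this excludes
    \<open>K = carrier_vec d'\<close> and \<open>R = {0\<^sub>v d}\<close> below.\<close>
  have nz': "\<exists>v\<in>carrier_vec d'. T *\<^sub>v v \<noteq> 0\<^sub>v d"
  proof (rule ccontr)
    assume *: "\<not> ?thesis"
    have "T = 0\<^sub>m d d'"
    proof (rule eq_matI)
      fix i j assume "i < dim_row (0\<^sub>m d d' :: complex mat)" "j < dim_col (0\<^sub>m d d' :: complex mat)"
      then have ij: "i < d" "j < d'" by auto
      have "(T *\<^sub>v unit_vec d' j) $ i = T $$ (i,j)"
        using T ij by simp
      then show "T $$ (i,j) = 0\<^sub>m d d' $$ (i,j)" using * ij by simp
    qed (use T in auto)
    then show False using nz by simp
  qed
  \<comment> \<open>Kernel and range of an intertwiner are invariant: irreducibility of \<sigma>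
    decides the kernel, irreducibility of \<rho> the range.\<close>
  define K where "K = {v \<in> carrier_vec d'. T *\<^sub>v v = 0\<^sub>v d}"
  have "subspace_vec d' K"
    unfolding subspace_vec_def K_def using T
    by (auto simp: mult_add_distrib_mat_vec[of _ d d'] mult_mat_vec[of _ d d'])
  moreover have "\<sigma> g *\<^sub>v v \<in> K" if "g \<in> carrier G" "v \<in> K" for g v
  proof -
    have "\<rho> g *\<^sub>v 0\<^sub>v d = 0\<^sub>v d" using rep_carrier[OF r that(1)] by auto
    then show ?thesis
      using that swap[of g v] rep_carrier[OF s that(1)] unfolding K_def by auto
  qed
  ultimately have "K = {0\<^sub>v d'} \<or> K = carrier_vec d'"
    using \<sigma> by (auto simp: irreducible_proj_rep_def)
  then have "K = {0\<^sub>v d'}" using nz' unfolding K_def by blast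
  then show "v = 0\<^sub>v d'" if "v \<in> carrier_vec d'" "T *\<^sub>v v = 0\<^sub>v d" for v
    using that unfolding K_def by blast
  define R where "R = (\<lambda>v. T *\<^sub>v v) ` carrier_vec d'"
  have "subspace_vec d R"
    unfolding subspace_vec_def
  proof (intro conjI ballI allI)
    show "R \<subseteq> carrier_vec d" using T by (auto simp: R_def)
    show "0\<^sub>v d \<in> R" unfolding R_def by (rule image_eqI[of _ _ "0\<^sub>v d'"]) (use T in auto)
  next
    fix u v assume "u \<in> R" "v \<in> R"
    then obtain u' v' where "u = T *\<^sub>v u'" "v = T *\<^sub>v v'" "u' \<in> carrier_vec d'" "v' \<in> carrier_vec d'"
      by (auto simp: R_def)
    then show "u + v \<in> R" unfolding R_def
      by (intro image_eqI[of _ _ "u' + v'"]) (use T in \<open>auto simp: mult_add_distrib_mat_vec[of _ d d']\<close>)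
  next
    fix a u assume "u \<in> R"
    then obtain u' where "u = T *\<^sub>v u'" "u' \<in> carrier_vec d'" by (auto simp: R_def)
    then show "a \<cdot>\<^sub>v u \<in> R" unfolding R_def
      by (intro image_eqI[of _ _ "a \<cdot>\<^sub>v u'"]) (use T in \<open>auto simp: mult_mat_vec[of _ d d']\<close>)
  qed
  moreover have "\<rho> g *\<^sub>v v \<in> R" if "g \<in> carrier G" "v \<in> R" for g v
    using that swap[of g] rep_carrier[OF s that(1)] by (auto simp: R_def)
  ultimately have "R = {0\<^sub>v d} \<or> R = carrier_vec d"
    using \<rho> by (auto simp: irreducible_proj_rep_def)
  then have "R = carrier_vec d" using nz' unfolding R_def by blast
  then show "\<exists>v\<in>carrier_vec d'. T *\<^sub>v v = w" if "w \<in> carrier_vec d" for w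
    using that unfolding R_def by (metis imageE)
qed

text \<open>A bijective intertwiner is an equivalence, directed from \<sigma> to \<rho> as T is. A
  complete system is inequivalent in both orders of each pair, so this direction can be contradicted
  later.\<close>

lemma schur_equiv:
  assumes \<rho>: "irreducible_proj_rep G \<omega> d \<rho>" and \<sigma>: "irreducible_proj_rep G \<omega> d' \<sigma>"
    and T: "T \<in> carrier_mat d d'" and inter: "\<And>g. g \<in> carrier G \<Longrightarrow> \<rho> g * T = T * \<sigma> g"
    and nz: "T \<noteq> 0\<^sub>m d d'"
  shows "equiv_proj_rep G d' \<sigma> d \<rho>"
proof -
  note kr = irreducible_kernel_range[OF \<rho> \<sigma> T inter nz]
  have "\<exists>v. v \<in> carrier_vec d' \<and> T *\<^sub>v v = unit_vec d i" for i
    using kr(2)[of "unit_vec d i"] by auto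
  \<comment> \<open>Preimages of the unit vectors, taken as columns, form a right inverse of
    T.\<close>
  then obtain a where a: "\<And>i. a i \<in> carrier_vec d'" "\<And>i. T *\<^sub>v a i = unit_vec d i" by metis
  define A where "A = mat d' d (\<lambda>(i,j). a j $ i)"
  have A: "A \<in> carrier_mat d' d" by (simp add: A_def)
  have TA: "T * A = 1\<^sub>m d"
  proof (rule eq_matI)
    fix i j assume "i < dim_row (1\<^sub>m d :: complex mat)" "j < dim_col (1\<^sub>m d :: complex mat)"
    then have ij: "i < d" "j < d" by auto
    have "(T * A) $$ (i,j) = (T *\<^sub>v a j) $ i"
      using ij mat_mult_entry[OF T A ij] mat_vec_entry[OF T a(1) ij(1), of j]
      by (simp add: A_def del: index_mult_mat index_mult_mat_vec)
    then show "(T * A) $$ (i,j) = 1\<^sub>m d $$ (i,j)" using a(2) ij by simp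
  qed (use T A in auto)
  have AT: "A * T = 1\<^sub>m d'"
  proof (rule eq_matI)
    fix i j assume "i < dim_row (1\<^sub>m d' :: complex mat)" "j < dim_col (1\<^sub>m d' :: complex mat)"
    then have ij: "i < d'" "j < d'" by auto
    let ?u = "unit_vec d' j :: complex vec"
    have "T *\<^sub>v (A *\<^sub>v (T *\<^sub>v ?u)) = (T * A) *\<^sub>v (T *\<^sub>v ?u)"
      using T A by (intro assoc_mult_mat_vec[symmetric, of _ d d' _ d]) auto
    also have "\<dots> = T *\<^sub>v ?u" unfolding TA by (rule one_mult_mat_vec) (use T in auto)
    \<comment> \<open>\<open>A *\<^sub>v (T *\<^sub>v ?u)\<close> and \<open>?u\<close> have the
      same image under T, so injectivity makes A a left inverse as well.\<close>
    finally have "T *\<^sub>v (A *\<^sub>v (T *\<^sub>v ?u) - ?u) = 0\<^sub>v d"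
      using T A by (subst mult_minus_distrib_mat_vec[of _ d d']) auto
    then have *: "A *\<^sub>v (T *\<^sub>v ?u) - ?u = 0\<^sub>v d'"
      by (intro kr(1)) (use T A in auto)
    have "(A * T) $$ (i,j) = ((A * T) *\<^sub>v ?u) $ i"
      using T A ij by (simp del: assoc_mult_mat_vec)
    also have "\<dots> = (A *\<^sub>v (T *\<^sub>v ?u)) $ i"
      using T A by (subst assoc_mult_mat_vec[of _ d' d _ d']) auto
    also have "\<dots> = (A *\<^sub>v (T *\<^sub>v ?u) - ?u) $ i + ?u $ i" using ij A by simp
    finally show "(A * T) $$ (i,j) = 1\<^sub>m d' $$ (i,j)" unfolding * using ij by simp
  qed (use T A in auto)
  have "d = d'"
    using left_inverse_dim_le[OF T A TA] left_inverse_dim_le[OF A T AT] by simp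
  moreover have "invertible_mat T"
    unfolding invertible_mat_def inverts_mat_def using T A TA AT \<open>d = d'\<close> by auto
  ultimately show ?thesis using T inter unfolding equiv_proj_rep_def by metis
qed

text \<open>Since d > 0, T has a complex eigenvalue c. Then T minus c times the identity commutes
  with \<rho> but kills an eigenvector, so it is not injective and must vanish.\<close>

lemma schur_scalar:
  assumes \<rho>: "irreducible_proj_rep G \<omega> d \<rho>"
    and T: "T \<in> carrier_mat d d" and inter: "\<And>g. g \<in> carrier G \<Longrightarrow> \<rho> g * T = T * \<rho> g"
  shows "\<exists>c. T = c \<cdot>\<^sub>m 1\<^sub>m d"
proof -
  have d: "d > 0" and r: "proj_unitary_rep G \<omega> d \<rho>" using \<rho> by (auto simp: irreducible_proj_rep_def)
  obtain c where "eigenvalue T c" using spectrum_non_empty[OF T d] by (auto simp: spectrum_def)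
  then obtain v where v: "v \<in> carrier_vec d" "v \<noteq> 0\<^sub>v d" "T *\<^sub>v v = c \<cdot>\<^sub>v v"
    using T by (auto simp: eigenvalue_def eigenvector_def)
  define N where "N = T - c \<cdot>\<^sub>m 1\<^sub>m d"
  have N: "N \<in> carrier_mat d d" using T unfolding N_def by (intro minus_carrier_mat) auto
  have "\<rho> g * N = N * \<rho> g" if "g \<in> carrier G" for g
    using T inter[OF that] rep_carrier[OF r that] unfolding N_def
    by (simp add: mult_minus_distrib_mat[of _ d d _ d] minus_mult_distrib_mat[of _ d d _ _ d]
        mult_smult_distrib[of _ d d _ d] mult_smult_assoc_mat[of _ d d _ d])
  moreover have "N *\<^sub>v v = 0\<^sub>v d"
  proof -
    have "(c \<cdot>\<^sub>m 1\<^sub>m d) *\<^sub>v v = c \<cdot>\<^sub>v v" using v by (intro eq_vecI) auto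
    then show ?thesis using T v unfolding N_def by (subst minus_mult_distrib_mat_vec[of _ d d]) auto
  qed
  ultimately have "N = 0\<^sub>m d d" using irreducible_kernel_range(1)[OF \<rho> \<rho> N] v by blast
  then have "T $$ (i,j) = (c \<cdot>\<^sub>m 1\<^sub>m d) $$ (i,j)" if "i < d" "j < d" for i j
  proof -
    have "N $$ (i,j) = 0" using \<open>N = 0\<^sub>m d d\<close> that by simp
    moreover have "N $$ (i,j) = T $$ (i,j) - (c \<cdot>\<^sub>m 1\<^sub>m d) $$ (i,j)"
      using that T unfolding N_def by (intro index_minus_mat) auto
    ultimately show ?thesis by simp
  qed
  then have "T = c \<cdot>\<^sub>m 1\<^sub>m d" using T by (intro eq_matI) auto
  then show ?thesis by blast
qed

text \<open>T is the sum over the group of \<open>\<rho> g * E * cadj (\<sigma> g)\<close>, with E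
  the matrix unit at (j, l). Translating g by h works because the phase \<open>\<omega> h g\<close>
  produced by \<open>\<rho> h * \<rho> g\<close> is also the one that turns
  \<open>cadj (\<sigma> g)\<close> into \<open>cadj (\<sigma> (h \<otimes> g)) * \<sigma> h\<close>:
  both representations have the same cocycle.\<close>

lemma matrix_coeff_average:
  assumes \<rho>: "proj_unitary_rep G \<omega> d \<rho>" and \<sigma>: "proj_unitary_rep G \<omega> d' \<sigma>"
    and j: "j < d" and l: "l < d'" and h: "h \<in> carrier G"
  defines "T \<equiv> mat d d' (\<lambda>(i,k). \<Sum>g\<in>carrier G. \<rho> g $$ (i,j) * cnj (\<sigma> g $$ (k,l)))"
  shows "\<rho> h * T = T * \<sigma> h"
proof (rule eq_matI)
  have T: "T \<in> carrier_mat d d'" by (simp add: T_def)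
  note rc = rep_carrier[OF \<rho> h] and sc = rep_carrier[OF \<sigma> h]
  fix i k assume "i < dim_row (T * \<sigma> h)" "k < dim_col (T * \<sigma> h)"
  then have i: "i < d" and k: "k < d'" using T sc by auto
  have "(\<rho> h * T) $$ (i,k) = (\<Sum>m<d. \<rho> h $$ (i,m) * (\<Sum>g\<in>carrier G. \<rho> g $$ (m,j) * cnj (\<sigma> g $$ (k,l))))"
    using i k by (subst mat_mult_entry[OF rc T]) (auto simp: T_def)
  also have "\<dots> = (\<Sum>g\<in>carrier G. (\<Sum>m<d. \<rho> h $$ (i,m) * \<rho> g $$ (m,j)) * cnj (\<sigma> g $$ (k,l)))"
    by (simp add: sum_distrib_left sum_distrib_right mult.assoc, rule sum.swap)
  also have "\<dots> = (\<Sum>g\<in>carrier G. \<omega> h g * \<rho> (h \<otimes> g) $$ (i,j) * cnj (\<sigma> g $$ (k,l)))"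
    using i j h \<rho> by (simp add: rep_mult_entry)
  also have "\<dots> = (\<Sum>g\<in>carrier G. \<rho> (h \<otimes> g) $$ (i,j) * (\<Sum>m<d'. cnj (\<sigma> (h \<otimes> g) $$ (m,l)) * \<sigma> h $$ (m,k)))"
    using k l h \<sigma> by (simp add: rep_adj_mult_entry) (simp add: mult_ac)
  also have "\<dots> = (\<Sum>g\<in>carrier G. \<rho> g $$ (i,j) * (\<Sum>m<d'. cnj (\<sigma> g $$ (m,l)) * \<sigma> h $$ (m,k)))"
    by (rule sum_translate[OF h, symmetric])
  also have "\<dots> = (\<Sum>m<d'. (\<Sum>g\<in>carrier G. \<rho> g $$ (i,j) * cnj (\<sigma> g $$ (m,l))) * \<sigma> h $$ (m,k))"
    by (simp add: sum_distrib_left sum_distrib_right mult.assoc, rule sum.swap)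
  also have "\<dots> = (T * \<sigma> h) $$ (i,k)"
    using i k by (subst mat_mult_entry[OF T sc]) (auto simp: T_def)
  finally show "(\<rho> h * T) $$ (i,k) = (T * \<sigma> h) $$ (i,k)" .
qed (use rep_carrier[OF \<rho> h] rep_carrier[OF \<sigma> h] in \<open>auto simp: T_def\<close>)

lemma schur_orthogonality_inequiv:
  assumes \<rho>: "irreducible_proj_rep G \<omega> d \<rho>" and \<sigma>: "irreducible_proj_rep G \<omega> d' \<sigma>"
    and ne: "\<not> equiv_proj_rep G d' \<sigma> d \<rho>"
    and "i < d" "j < d" "k < d'" "l < d'"
  shows "(\<Sum>g\<in>carrier G. \<rho> g $$ (i,j) * cnj (\<sigma> g $$ (k,l))) = 0"
proof -
  have r: "proj_unitary_rep G \<omega> d \<rho>" and s: "proj_unitary_rep G \<omega> d' \<sigma>"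
    using \<rho> \<sigma> by (auto simp: irreducible_proj_rep_def)
  define T where "T = mat d d' (\<lambda>(i,k). \<Sum>g\<in>carrier G. \<rho> g $$ (i,j) * cnj (\<sigma> g $$ (k,l)))"
  have T: "T \<in> carrier_mat d d'" by (simp add: T_def)
  have "T = 0\<^sub>m d d'"
    using schur_equiv[OF \<rho> \<sigma> T] matrix_coeff_average[OF r s \<open>j < d\<close> \<open>l < d'\<close>] ne
    unfolding T_def by blast
  then have "T $$ (i,k) = 0" using assms by simp
  then show ?thesis using assms by (simp add: T_def)
qed

lemma schur_orthogonality:
  assumes \<rho>: "irreducible_proj_rep G \<omega> d \<rho>" and ij: "i < d" "j < d" "k < d" "l < d"
  shows "(\<Sum>g\<in>carrier G. \<rho> g $$ (i,j) * cnj (\<rho> g $$ (k,l)))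
    = (if i = k \<and> j = l then of_nat (card (carrier G)) / of_nat d else 0)"
proof -
  have r: "proj_unitary_rep G \<omega> d \<rho>" using \<rho> by (auto simp: irreducible_proj_rep_def)
  define T where "T = mat d d (\<lambda>(i,k). \<Sum>g\<in>carrier G. \<rho> g $$ (i,j) * cnj (\<rho> g $$ (k,l)))"
  have T: "T \<in> carrier_mat d d" by (simp add: T_def)
  obtain c where c: "T = c \<cdot>\<^sub>m 1\<^sub>m d"
    using schur_scalar[OF \<rho> T] matrix_coeff_average[OF r r ij(2,4)] unfolding T_def by blast
  \<comment> \<open>The scalar is read off from the trace. By unitarity of each
    \<open>\<rho> g\<close> the trace of T is |G| if j = l and 0 otherwise, whence the constant |G|
    / d.\<close>
  have "of_nat d * c = (\<Sum>m<d. T $$ (m,m))" using c by simp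
  also have "\<dots> = (\<Sum>g\<in>carrier G. \<Sum>m<d. cnj (\<rho> g $$ (m,l)) * \<rho> g $$ (m,j))"
    by (subst sum.swap) (simp add: T_def mult.commute)
  also have "\<dots> = (if j = l then of_nat (card (carrier G)) else 0)"
    using ij r by (simp add: rep_column_orthonormal)
  finally have "c = (if j = l then of_nat (card (carrier G)) / of_nat d else 0)"
    using ij by (auto simp: field_simps split: if_splits)
  moreover have "(\<Sum>g\<in>carrier G. \<rho> g $$ (i,j) * cnj (\<rho> g $$ (k,l))) = T $$ (i,k)"
    using ij by (simp add: T_def)
  ultimately show ?thesis using c ij by auto
qed

section \<open>Subrepresentations on invariant subspaces\<close>

lemma subrepresentation:
  assumes \<tau>: "proj_unitary_rep G \<omega> n \<tau>" and S: "subspace_vec n S"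
    and inv: "\<And>g v. g \<in> carrier G \<Longrightarrow> v \<in> S \<Longrightarrow> \<tau> g *\<^sub>v v \<in> S"
  shows "\<exists>k V \<sigma>. V \<in> carrier_mat n k \<and> k \<le> n \<and> cadj V * V = 1\<^sub>m k
    \<and> (\<forall>w\<in>carrier_vec k. V *\<^sub>v w \<in> S) \<and> (\<forall>v\<in>S. V *\<^sub>v (cadj V *\<^sub>v v) = v)
    \<and> proj_unitary_rep G \<omega> k \<sigma> \<and> (\<forall>g\<in>carrier G. \<tau> g * V = V * \<sigma> g)"
proof -
  obtain k V where V: "V \<in> carrier_mat n k" "k \<le> n" "cadj V * V = 1\<^sub>m k"
    and VS: "\<And>w. w \<in> carrier_vec k \<Longrightarrow> V *\<^sub>v w \<in> S"
    and SV: "\<And>v. v \<in> S \<Longrightarrow> V *\<^sub>v (cadj V *\<^sub>v v) = v"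
    using subspace_isometry[OF S] by blast
  have V': "cadj V \<in> carrier_mat k n" using V by simp
  \<comment> \<open>The compression of \<tau> to the range of V. It is intertwined by V because
    \<open>V * cadj V\<close> acts as the identity on the invariant subspace S.\<close>
  define \<sigma> where "\<sigma> g = cadj V * (\<tau> g * V)" for g
  have tc: "\<tau> g \<in> carrier_mat n n" "\<tau> g * V \<in> carrier_mat n k" if "g \<in> carrier G" for g
    using rep_carrier[OF \<tau> that] V by auto
  have sc: "\<sigma> g \<in> carrier_mat k k" if "g \<in> carrier G" for g
    using mult_carrier_mat[OF V' tc(2)[OF that]] by (simp add: \<sigma>_def)
  have inter: "\<tau> g * V = V * \<sigma> g" if g: "g \<in> carrier G" for g
  proof (rule eq_matI)
    fix i j assume "i < dim_row (V * \<sigma> g)" "j < dim_col (V * \<sigma> g)"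
    then have ij: "i < n" "j < k" using V sc[OF g] by auto
    let ?u = "unit_vec k j :: complex vec"
    have e: "(A * B) $$ (i,j) = (A *\<^sub>v (B *\<^sub>v ?u)) $ i"
      if "A \<in> carrier_mat n m" "B \<in> carrier_mat m k" for A B m
    proof -
      have "(A * B) $$ (i,j) = ((A * B) *\<^sub>v ?u) $ i"
        using that ij by (simp del: assoc_mult_mat_vec)
      then show ?thesis using assoc_mult_mat_vec[OF that, of ?u] by simp
    qed
    have *: "\<tau> g *\<^sub>v (V *\<^sub>v ?u) \<in> S" by (intro inv g VS) simp
    have "\<sigma> g *\<^sub>v ?u = cadj V *\<^sub>v ((\<tau> g * V) *\<^sub>v ?u)"
      unfolding \<sigma>_def by (rule assoc_mult_mat_vec[OF V' tc(2)[OF g]]) simp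
    also have "(\<tau> g * V) *\<^sub>v ?u = \<tau> g *\<^sub>v (V *\<^sub>v ?u)"
      by (rule assoc_mult_mat_vec[OF tc(1)[OF g] V(1)]) simp
    finally have "V *\<^sub>v (\<sigma> g *\<^sub>v ?u) = \<tau> g *\<^sub>v (V *\<^sub>v ?u)" using SV[OF *] by simp
    then show "(\<tau> g * V) $$ (i,j) = (V * \<sigma> g) $$ (i,j)"
      using e[OF tc(1)[OF g] V(1)] e[OF V(1) sc[OF g]] by simp
  qed (use V tc sc g in auto)
  have cancel: "A = B" if "V * A = V * B" "A \<in> carrier_mat k k" "B \<in> carrier_mat k k" for A B
  proof -
    have "cadj V * (V * C) = C" if "C \<in> carrier_mat k k" for C
      using assoc_mult_mat[OF V' V(1) that] V(3) that by simp
    from this[OF that(2)] this[OF that(3)] show ?thesis unfolding that(1) by simp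
  qed
  have "proj_unitary_rep G \<omega> k \<sigma>"
    unfolding proj_unitary_rep_def
  proof (intro conjI ballI)
    fix g assume g: "g \<in> carrier G"
    have s': "cadj (\<sigma> g) \<in> carrier_mat k k" using sc[OF g] by simp
    have t': "cadj (\<tau> g) \<in> carrier_mat n n" using tc[OF g] by simp
    \<comment> \<open>Unitarity of \<open>\<sigma> g\<close>: the matrix
      \<open>V * \<sigma> g = \<tau> g * V\<close> is an isometry by its second form, and V cancels
      from its Gram matrix by its first.\<close>
    have "cadj (V * \<sigma> g) * (V * \<sigma> g) = cadj (\<sigma> g) * \<sigma> g"
    proof -
      have "cadj (V * \<sigma> g) * (V * \<sigma> g) = (cadj (\<sigma> g) * cadj V) * (V * \<sigma> g)"
        using cadj_mult[OF V(1) sc[OF g]] by simp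
      also have "\<dots> = cadj (\<sigma> g) * (cadj V * (V * \<sigma> g))"
        by (rule assoc_mult_mat[OF s' V']) (use V sc[OF g] in auto)
      also have "cadj V * (V * \<sigma> g) = (cadj V * V) * \<sigma> g"
        by (rule assoc_mult_mat[OF V' V(1) sc[OF g], symmetric])
      finally show ?thesis using V sc[OF g] by simp
    qed
    moreover have "cadj (\<tau> g * V) * (\<tau> g * V) = 1\<^sub>m k"
    proof -
      have "cadj (\<tau> g * V) * (\<tau> g * V) = (cadj V * cadj (\<tau> g)) * (\<tau> g * V)"
        using cadj_mult[OF tc(1)[OF g] V(1)] by simp
      also have "\<dots> = cadj V * (cadj (\<tau> g) * (\<tau> g * V))"
        by (rule assoc_mult_mat[OF V' t' tc(2)[OF g]])
      also have "cadj (\<tau> g) * (\<tau> g * V) = (cadj (\<tau> g) * \<tau> g) * V"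
        by (rule assoc_mult_mat[OF t' tc(1)[OF g] V(1), symmetric])
      finally show ?thesis using V rep_adj_mult[OF \<tau> g] by simp
    qed
    ultimately have "cadj (\<sigma> g) * \<sigma> g = 1\<^sub>m k" using inter[OF g] by simp
    then show "unitary_mat k (\<sigma> g)"
      using mat_mult_left_right_inverse[OF s' sc[OF g]] sc[OF g] by (simp add: unitary_mat_def)
  next
    fix g h assume g: "g \<in> carrier G" and h: "h \<in> carrier G"
    then have gh: "g \<otimes> h \<in> carrier G" by simp
    have "V * (\<sigma> g * \<sigma> h) = (V * \<sigma> g) * \<sigma> h"
      by (rule assoc_mult_mat[OF V(1) sc[OF g] sc[OF h], symmetric])
    also have "\<dots> = (\<tau> g * V) * \<sigma> h" by (simp add: inter g)
    also have "\<dots> = \<tau> g * (V * \<sigma> h)"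
      by (rule assoc_mult_mat[OF tc(1)[OF g] V(1) sc[OF h]])
    also have "\<dots> = \<tau> g * (\<tau> h * V)" by (simp add: inter h)
    also have "\<dots> = (\<tau> g * \<tau> h) * V"
      by (rule assoc_mult_mat[OF tc(1)[OF g] tc(1)[OF h] V(1), symmetric])
    also have "\<dots> = \<omega> g h \<cdot>\<^sub>m (\<tau> (g \<otimes> h) * V)"
      unfolding rep_mult[OF \<tau> g h] by (rule mult_smult_assoc_mat[OF tc(1)[OF gh] V(1)])
    also have "\<dots> = \<omega> g h \<cdot>\<^sub>m (V * \<sigma> (g \<otimes> h))" by (simp add: inter gh)
    also have "\<dots> = V * (\<omega> g h \<cdot>\<^sub>m \<sigma> (g \<otimes> h))"
      by (rule mult_smult_distrib[OF V(1) sc[OF gh], symmetric])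
    finally show "\<sigma> g * \<sigma> h = \<omega> g h \<cdot>\<^sub>m \<sigma> (g \<otimes> h)"
      by (rule cancel) (use sc[OF g] sc[OF h] sc[OF gh] in auto)
  qed
  then show ?thesis using V VS SV inter by blast
qed

text \<open>Take an isometric subrepresentation inside S of least positive dimension k. An invariant
  subspace of its representation space comes from an isometry W of its own, and \<open>V * W\<close>
  competes with V; so that subspace is zero, or W is square and the subspace is everything.\<close>

lemma exists_irreducible_subrepresentation:
  assumes \<tau>: "proj_unitary_rep G \<omega> n \<tau>" and S: "subspace_vec n S" "S \<noteq> {0\<^sub>v n}"
    and inv: "\<And>g v. g \<in> carrier G \<Longrightarrow> v \<in> S \<Longrightarrow> \<tau> g *\<^sub>v v \<in> S"
  shows "\<exists>k V \<sigma>. V \<in> carrier_mat n k \<and> cadj V * V = 1\<^sub>m k \<and> (\<forall>w\<in>carrier_vec k. V *\<^sub>v w \<in> S)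
    \<and> irreducible_proj_rep G \<omega> k \<sigma> \<and> (\<forall>g\<in>carrier G. \<tau> g * V = V * \<sigma> g)"
proof -
  define P where "P k V \<sigma> \<longleftrightarrow> k > 0 \<and> V \<in> carrier_mat n k \<and> cadj V * V = 1\<^sub>m k
    \<and> (\<forall>w\<in>carrier_vec k. V *\<^sub>v w \<in> S) \<and> proj_unitary_rep G \<omega> k \<sigma>
    \<and> (\<forall>g\<in>carrier G. \<tau> g * V = V * \<sigma> g)" for k V \<sigma>
  \<comment> \<open>An isometry without columns describes only the zero subspace. This gives k > 0
    at the start and settles the case j = 0 below.\<close>
  have zero: "T = {0\<^sub>v m}" if "W \<in> carrier_mat m 0" "\<forall>v\<in>T. W *\<^sub>v (cadj W *\<^sub>v v) = v" "subspace_vec m T"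
    for W m T
  proof -
    have W0: "W *\<^sub>v x = 0\<^sub>v m" if "x \<in> carrier_vec 0" for x
      using that \<open>W \<in> carrier_mat m 0\<close> by (intro eq_vecI) (auto simp: scalar_prod_def)
    have c: "cadj W *\<^sub>v v \<in> carrier_vec 0" for v
      by (rule carrier_vecI) (use \<open>W \<in> carrier_mat m 0\<close> in simp)
    have "v = 0\<^sub>v m" if "v \<in> T" for v
      using that W0[OF c[of v]] \<open>\<forall>v\<in>T. W *\<^sub>v (cadj W *\<^sub>v v) = v\<close> by metis
    then show ?thesis using that(3) by (auto simp: subspace_vec_def)
  qed
  have "\<exists>k V \<sigma>. P k V \<sigma>"
  proof -
    obtain k V \<sigma> where *: "V \<in> carrier_mat n k \<and> k \<le> n \<and> cadj V * V = 1\<^sub>m k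
    \<and> (\<forall>w\<in>carrier_vec k. V *\<^sub>v w \<in> S) \<and> (\<forall>v\<in>S. V *\<^sub>v (cadj V *\<^sub>v v) = v)
    \<and> proj_unitary_rep G \<omega> k \<sigma> \<and> (\<forall>g\<in>carrier G. \<tau> g * V = V * \<sigma> g)"
      using subrepresentation[OF \<tau> S(1) inv] by blast
    moreover have "k > 0"
      using zero[of V n S] * S by (cases k) auto
    ultimately have "P k V \<sigma>" by (auto simp: P_def)
    then show ?thesis by blast
  qed
  then obtain k where ex: "\<exists>V \<sigma>. P k V \<sigma>" and least: "\<And>j. \<exists>V \<sigma>. P j V \<sigma> \<Longrightarrow> k \<le> j"
    using LeastI_ex[of "\<lambda>k. \<exists>V \<sigma>. P k V \<sigma>"] Least_le[of "\<lambda>k. \<exists>V \<sigma>. P k V \<sigma>"] by blast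
  from ex obtain V \<sigma> where "P k V \<sigma>" by blast
  then have V: "k > 0" "V \<in> carrier_mat n k" "cadj V * V = 1\<^sub>m k"
    "\<And>w. w \<in> carrier_vec k \<Longrightarrow> V *\<^sub>v w \<in> S" and \<sigma>: "proj_unitary_rep G \<omega> k \<sigma>"
    and inter: "\<And>g. g \<in> carrier G \<Longrightarrow> \<tau> g * V = V * \<sigma> g"
    by (auto simp: P_def)
  have "T = {0\<^sub>v k} \<or> T = carrier_vec k"
    if T: "subspace_vec k T" and Tinv: "\<And>g v. g \<in> carrier G \<Longrightarrow> v \<in> T \<Longrightarrow> \<sigma> g *\<^sub>v v \<in> T" for T
  proof -
    obtain j W \<sigma>' where W: "W \<in> carrier_mat k j" "j \<le> k" "cadj W * W = 1\<^sub>m j"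
      "\<And>w. w \<in> carrier_vec j \<Longrightarrow> W *\<^sub>v w \<in> T" and TW: "\<forall>v\<in>T. W *\<^sub>v (cadj W *\<^sub>v v) = v"
      and \<sigma>': "proj_unitary_rep G \<omega> j \<sigma>'" and inter': "\<And>g. g \<in> carrier G \<Longrightarrow> \<sigma> g * W = W * \<sigma>' g"
      using subrepresentation[OF \<sigma> T Tinv] by blast
    have W': "cadj W \<in> carrier_mat j k" using W by simp
    show ?thesis
    proof (cases "j = 0")
      case True
      then show ?thesis using zero[of W k T] W TW T by blast
    next
      case False
      have V': "cadj V \<in> carrier_mat k n" using V by simp
      have VW: "V * W \<in> carrier_mat n j" using V W by auto
      have "P j (V * W) \<sigma>'"
        unfolding P_def
      proof (intro conjI ballI)
        have "cadj (V * W) * (V * W) = (cadj W * cadj V) * (V * W)"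
          using cadj_mult[OF V(2) W(1)] by simp
        also have "\<dots> = cadj W * (cadj V * (V * W))"
          by (rule assoc_mult_mat[OF W' V' VW])
        also have "cadj V * (V * W) = (cadj V * V) * W"
          by (rule assoc_mult_mat[OF V' V(2) W(1), symmetric])
        finally show "cadj (V * W) * (V * W) = 1\<^sub>m j" using V W by simp
      next
        fix w :: "complex vec" assume w: "w \<in> carrier_vec j"
        have "(V * W) *\<^sub>v w = V *\<^sub>v (W *\<^sub>v w)" by (rule assoc_mult_mat_vec[OF V(2) W(1) w])
        then show "(V * W) *\<^sub>v w \<in> S" using V(4)[of "W *\<^sub>v w"] W w by auto
      next
        fix g assume g: "g \<in> carrier G"
        note c = rep_carrier[OF \<tau> g] rep_carrier[OF \<sigma> g] rep_carrier[OF \<sigma>' g]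
        have "\<tau> g * (V * W) = (\<tau> g * V) * W"
          by (rule assoc_mult_mat[OF c(1) V(2) W(1), symmetric])
        also have "\<dots> = V * (\<sigma> g * W)"
          unfolding inter[OF g] by (rule assoc_mult_mat[OF V(2) c(2) W(1)])
        also have "\<dots> = V * W * \<sigma>' g"
          unfolding inter'[OF g] by (rule assoc_mult_mat[OF V(2) W(1) c(3), symmetric])
        finally show "\<tau> g * (V * W) = V * W * \<sigma>' g" .
      qed (use False VW \<sigma>' in auto)
      then have "k \<le> j" using least by blast
      then have j: "j = k" using W by simp
      then have "W * cadj W = 1\<^sub>m k"
        using mat_mult_left_right_inverse[of "cadj W" k W] W by simp
      have "v \<in> T" if v: "v \<in> carrier_vec k" for v
      proof -
        have "v = (W * cadj W) *\<^sub>v v" using v \<open>W * cadj W = 1\<^sub>m k\<close> by simp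
        also have "\<dots> = W *\<^sub>v (cadj W *\<^sub>v v)" by (rule assoc_mult_mat_vec[OF W(1) W' v])
        finally show ?thesis using W(4)[of "cadj W *\<^sub>v v"] W' v by (metis mult_mat_vec_carrier)
      qed
      then show ?thesis using T by (auto simp: subspace_vec_def)
    qed
  qed
  then have "irreducible_proj_rep G \<omega> k \<sigma>"
    using V(1) \<sigma> unfolding irreducible_proj_rep_def by blast
  then show ?thesis using V inter by blast
qed

end

section \<open>Completeness of the matrix coefficients\<close>

locale irrep_system = finite_group_cocycle +
  fixes e :: "nat \<Rightarrow> 'a" and ds :: "nat list" and reps :: "('a \<Rightarrow> complex mat) list"
  assumes enum: "bij_betw e {..<card (carrier G)} (carrier G)"
    and complete: "complete_irrep_system G \<omega> ds reps"
begin

abbreviation "n \<equiv> card (carrier G)"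

definition ix :: "'a \<Rightarrow> nat" where "ix = the_inv_into {..<n} e"

lemma e_carrier: "a < n \<Longrightarrow> e a \<in> carrier G"
  using enum by (auto simp: bij_betw_def)

lemma e_ix: "g \<in> carrier G \<Longrightarrow> e (ix g) = g"
  unfolding ix_def using enum by (metis bij_betw_def f_the_inv_into_f)

lemma ix_less: "g \<in> carrier G \<Longrightarrow> ix g < n"
  unfolding ix_def using enum the_inv_into_into[of e "{..<n}" g "{..<n}"] by (auto simp: bij_betw_def)

lemma e_eq_iff: "g \<in> carrier G \<Longrightarrow> a < n \<Longrightarrow> e a = g \<longleftrightarrow> a = ix g"
  using e_ix ix_less enum by (metis bij_betw_def inj_onD lessThan_iff)

lemma e_inj: "a < n \<Longrightarrow> b < n \<Longrightarrow> e a = e b \<longleftrightarrow> a = b"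
  using enum by (auto simp: bij_betw_def dest: inj_onD)

lemma n_pos: "n > 0"
  using finite_G by (simp add: card_gt_0_iff) blast

lemma sum_enum: "(\<Sum>a<n. f (e a)) = (\<Sum>g\<in>carrier G. f g)"
  by (rule sum.reindex_bij_betw[OF enum])

text \<open>Twisted right translation. Since \<open>reg h\<close> sends \<open>v\<close> to a function with value \<open>v h\<close> at \<open>\<one>\<close>,
  a vector in a subrepresentation is a combination of its matrix coefficients.\<close>

definition reg :: "'a \<Rightarrow> complex mat" where
  "reg h = mat n n (\<lambda>(a,b). if e b = e a \<otimes> h then \<omega> (e a) h else 0)"

lemma reg_carrier: "reg h \<in> carrier_mat n n"
  by (simp add: reg_def)

lemma reg_sum:
  assumes "h \<in> carrier G" "a < n"
  shows "(\<Sum>b<n. reg h $$ (a,b) * f b) = \<omega> (e a) h * f (ix (e a \<otimes> h))"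
proof -
  have g: "e a \<otimes> h \<in> carrier G" using assms e_carrier by auto
  have "(\<Sum>b<n. reg h $$ (a,b) * f b) = (\<Sum>b<n. if b = ix (e a \<otimes> h) then \<omega> (e a) h * f b else 0)"
    using assms g e_eq_iff by (intro sum.cong) (auto simp: reg_def)
  then show ?thesis using ix_less[OF g] by simp
qed

text \<open>As an operator, \<open>reg h\<close> maps v to the function whose value at g is
  \<omega>(g,h) v(gh). Each row has a single entry, of modulus 1, in a column of its own, so the
  rows are orthonormal; the product law is the cocycle identity for the triple \<open>e a\<close>,
  h, k.\<close>

lemma reg_rep: "proj_unitary_rep G \<omega> n reg"
  unfolding proj_unitary_rep_def
proof (intro conjI ballI)
  fix h assume h: "h \<in> carrier G"
  have "reg h * cadj (reg h) = 1\<^sub>m n"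
  proof (rule eq_matI)
    fix a b assume "a < dim_row (1\<^sub>m n :: complex mat)" "b < dim_col (1\<^sub>m n :: complex mat)"
    then have ab: "a < n" "b < n" by auto
    have g: "e a \<otimes> h \<in> carrier G" using ab h e_carrier by auto
    have "(reg h * cadj (reg h)) $$ (a,b) = (\<Sum>c<n. reg h $$ (a,c) * cnj (reg h $$ (b,c)))"
      using ab by (subst mat_mult_entry[of _ n n _ n]) (auto simp: cadj_index reg_def intro!: sum.cong)
    also have "\<dots> = \<omega> (e a) h * cnj (reg h $$ (b, ix (e a \<otimes> h)))"
      by (rule reg_sum[OF h ab(1)])
    also have "\<dots> = (if a = b then 1 else 0)"
      using ab ix_less[OF g] e_ix[OF g] e_carrier h norm_cocycle e_inj
      by (auto simp: reg_def mult.commute)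
    finally show "(reg h * cadj (reg h)) $$ (a,b) = 1\<^sub>m n $$ (a,b)" using ab by simp
  qed (auto simp: reg_def)
  then show "unitary_mat n (reg h)"
    using mat_mult_left_right_inverse[of "reg h" n "cadj (reg h)"] reg_carrier[of h]
    by (simp add: unitary_mat_def)
next
  fix h k assume h: "h \<in> carrier G" and k: "k \<in> carrier G"
  show "reg h * reg k = \<omega> h k \<cdot>\<^sub>m reg (h \<otimes> k)"
  proof (rule eq_matI)
    fix a b assume "a < dim_row (\<omega> h k \<cdot>\<^sub>m reg (h \<otimes> k))" "b < dim_col (\<omega> h k \<cdot>\<^sub>m reg (h \<otimes> k))"
    then have ab: "a < n" "b < n" by (auto simp: reg_def)
    have g: "e a \<otimes> h \<in> carrier G" "e a \<in> carrier G" using ab h e_carrier by auto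
    have "(reg h * reg k) $$ (a,b) = (\<Sum>c<n. reg h $$ (a,c) * reg k $$ (c,b))"
      by (rule mat_mult_entry[OF reg_carrier reg_carrier ab])
    also have "\<dots> = \<omega> (e a) h * reg k $$ (ix (e a \<otimes> h), b)" by (rule reg_sum[OF h ab(1)])
    also have "\<dots> = (if e b = e a \<otimes> (h \<otimes> k) then \<omega> h k * \<omega> (e a) (h \<otimes> k) else 0)"
      using ab ix_less[OF g(1)] e_ix[OF g(1)] cocycle_assoc[OF g(2) h k] g h k
      by (simp add: reg_def m_assoc)
    finally show "(reg h * reg k) $$ (a,b) = (\<omega> h k \<cdot>\<^sub>m reg (h \<otimes> k)) $$ (a,b)"
      using ab by (simp add: reg_def)
  qed (auto simp: reg_def)
qed

lemma irrep: "\<alpha> < length ds \<Longrightarrow> irreducible_proj_rep G \<omega> (ds ! \<alpha>) (reps ! \<alpha>)"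
  using complete by (simp add: complete_irrep_system_def)

lemma irrep_rep: "\<alpha> < length ds \<Longrightarrow> proj_unitary_rep G \<omega> (ds ! \<alpha>) (reps ! \<alpha>)"
  using irrep by (auto simp: irreducible_proj_rep_def)

lemma ds_pos: "\<alpha> < length ds \<Longrightarrow> ds ! \<alpha> > 0"
  using irrep by (auto simp: irreducible_proj_rep_def)

text \<open>The orthogonal complement S of all coefficients is invariant under \<open>reg\<close>.
  If it were nonzero, it would contain an irreducible piece equivalent to a listed representation,
  whose vectors are combinations of coefficients and hence orthogonal to themselves.\<close>

lemma orthogonal_to_coeffs_eq_0:
  assumes v: "v \<in> carrier_vec n"
    and orth: "\<And>\<alpha> i j. \<alpha> < length ds \<Longrightarrow> i < ds ! \<alpha> \<Longrightarrow> j < ds ! \<alpha> \<Longrightarrow>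
      (\<Sum>x<n. cnj ((reps ! \<alpha>) (e x) $$ (i,j)) * v $ x) = 0"
  shows "v = 0\<^sub>v n"
proof -
  define S where "S = {v \<in> carrier_vec n. \<forall>\<alpha><length ds. \<forall>i<ds ! \<alpha>. \<forall>j<ds ! \<alpha>.
      (\<Sum>x<n. cnj ((reps ! \<alpha>) (e x) $$ (i,j)) * v $ x) = 0}"
  have S: "subspace_vec n S"
    unfolding subspace_vec_def S_def
    by (auto simp: distrib_left sum.distrib mult.left_commute simp flip: sum_distrib_left)
  have inv: "reg h *\<^sub>v v \<in> S" if h: "h \<in> carrier G" and v: "v \<in> S" for h v
  proof -
    have vc: "v \<in> carrier_vec n" using v by (simp add: S_def)
    have "(\<Sum>x<n. cnj ((reps ! \<alpha>) (e x) $$ (i,j)) * (reg h *\<^sub>v v) $ x) = 0"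
      if \<alpha>: "\<alpha> < length ds" and ij: "i < ds ! \<alpha>" "j < ds ! \<alpha>" for \<alpha> i j
    proof -
      let ?\<rho> = "reps ! \<alpha>" and ?d = "ds ! \<alpha>"
      have "(\<Sum>x<n. cnj (?\<rho> (e x) $$ (i,j)) * (reg h *\<^sub>v v) $ x)
          = (\<Sum>x<n. (\<omega> (e x) h * cnj (?\<rho> (e x) $$ (i,j))) * v $ ix (e x \<otimes> h))"
        by (intro sum.cong refl)
          (simp add: mat_vec_entry[OF reg_carrier vc] reg_sum[OF h] del: index_mult_mat_vec)
      also have "\<dots> = (\<Sum>g\<in>carrier G. (\<omega> g h * cnj (?\<rho> g $$ (i,j))) * v $ ix (g \<otimes> h))"
        by (rule sum_enum)
      \<comment> \<open>The phase is traded for entries of \<open>?\<rho> h\<close>; afterwards v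
        and the coefficient both stand at \<open>g \<otimes> h\<close>, and the sum can be
        translated.\<close>
      also have "\<dots> = (\<Sum>g\<in>carrier G. \<Sum>m<?d. ?\<rho> h $$ (j,m) * (cnj (?\<rho> (g \<otimes> h) $$ (i,m)) * v $ ix (g \<otimes> h)))"
        using rep_mult_adj_entry[OF irrep_rep[OF \<alpha>] _ h ij]
        by (intro sum.cong refl) (simp flip: mult.assoc sum_distrib_right)
      also have "\<dots> = (\<Sum>g\<in>carrier G. \<Sum>m<?d. ?\<rho> h $$ (j,m) * (cnj (?\<rho> g $$ (i,m)) * v $ ix g))"
        by (rule sum_translate_right[OF h])
      also have "\<dots> = (\<Sum>m<?d. ?\<rho> h $$ (j,m) * (\<Sum>g\<in>carrier G. cnj (?\<rho> g $$ (i,m)) * v $ ix g))"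
        unfolding sum_distrib_left by (rule sum.swap)
      also have "\<dots> = (\<Sum>m<?d. ?\<rho> h $$ (j,m) * (\<Sum>x<n. cnj (?\<rho> (e x) $$ (i,m)) * v $ x))"
        using e_carrier e_eq_iff by (simp add: sum_enum[symmetric]) (metis (no_types, lifting) lessThan_iff sum.cong)
      also have "\<dots> = 0" using v \<alpha> ij by (simp add: S_def)
      finally show ?thesis .
    qed
    then show ?thesis using mult_mat_vec_carrier[OF reg_carrier vc] by (simp add: S_def)
  qed
  have "S = {0\<^sub>v n}"
  proof (rule ccontr)
    assume "S \<noteq> {0\<^sub>v n}"
    then obtain k V \<sigma> where V: "V \<in> carrier_mat n k" and iso: "cadj V * V = 1\<^sub>m k"
      and VS: "\<And>w. w \<in> carrier_vec k \<Longrightarrow> V *\<^sub>v w \<in> S" and \<sigma>: "irreducible_proj_rep G \<omega> k \<sigma>"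
      and inter: "\<And>g. g \<in> carrier G \<Longrightarrow> reg g * V = V * \<sigma> g"
      using exists_irreducible_subrepresentation[OF reg_rep S _ inv] by blast
    have k: "k > 0" using \<sigma> by (simp add: irreducible_proj_rep_def)
    obtain \<alpha> where \<alpha>: "\<alpha> < length ds" and eqv: "equiv_proj_rep G k \<sigma> (ds ! \<alpha>) (reps ! \<alpha>)"
      using complete \<sigma> unfolding complete_irrep_system_def by blast
    let ?\<rho> = "reps ! \<alpha>"
    have kd: "ds ! \<alpha> = k" using eqv by (simp add: equiv_proj_rep_def)
    obtain T where T: "T \<in> carrier_mat k k" "invertible_mat T" and T\<sigma>: "\<And>g. g \<in> carrier G \<Longrightarrow> T * \<sigma> g = ?\<rho> g * T"
      using eqv by (auto simp: equiv_proj_rep_def)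
    obtain B where B: "B * T = 1\<^sub>m (dim_row B)" "T * B = 1\<^sub>m k"
      using T by (auto simp: invertible_mat_def inverts_mat_def)
    have Bc: "B \<in> carrier_mat k k"
    proof (rule carrier_matI)
      show "dim_row B = k" using arg_cong[OF B(1), of dim_col] T(1) by auto
      show "dim_col B = k" using arg_cong[OF B(2), of dim_col] by simp
    qed
    have BT: "B * T = 1\<^sub>m k" using B(1) Bc by simp
    \<comment> \<open>B is the inverse of T, so
      \<open>V * \<sigma> g = V * B * ?\<rho> g * T\<close>; Y collects the factors to the left of
      \<open>?\<rho> g\<close>.\<close>
    define Y where "Y = V * B"
    have Y: "Y \<in> carrier_mat n k" using V Bc by (auto simp: Y_def)
    \<comment> \<open>Row \<open>ix \<one>\<close> of \<open>reg g * V\<close> is the row of V at g,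
      because \<open>\<omega> \<one> g = 1\<close>. Column 0 exists since k > 0, and one column is
      enough for the contradiction.\<close>
    have span: "V $$ (x,0) = (\<Sum>p<k. \<Sum>q<k. Y $$ (ix \<one>,p) * T $$ (q,0) * ?\<rho> (e x) $$ (p,q))" if x: "x < n" for x
    proof -
      let ?g = "e x"
      have g: "?g \<in> carrier G" by (rule e_carrier[OF x])
      have one: "ix \<one> < n" by (rule ix_less) simp
      have \<rho>c: "?\<rho> ?g \<in> carrier_mat k k" using rep_carrier[OF irrep_rep[OF \<alpha>] g] kd by simp
      have \<sigma>c: "\<sigma> ?g \<in> carrier_mat k k" using \<sigma> rep_carrier g by (auto simp: irreducible_proj_rep_def)
      have "\<sigma> ?g = (B * T) * \<sigma> ?g" using BT \<sigma>c by simp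
      also have "\<dots> = B * (?\<rho> ?g * T)" using T\<sigma>[OF g] assoc_mult_mat[OF Bc T(1) \<sigma>c] by simp
      finally have "V * \<sigma> ?g = V * (B * (?\<rho> ?g * T))" by simp
      also have "\<dots> = Y * (?\<rho> ?g * T)"
        unfolding Y_def by (rule assoc_mult_mat[symmetric, OF V Bc]) (use \<rho>c T in auto)
      finally have eq: "reg ?g * V = Y * (?\<rho> ?g * T)" using inter[OF g] by simp
      have "V $$ (x,0) = \<omega> (e (ix \<one>)) ?g * V $$ (ix (e (ix \<one>) \<otimes> ?g), 0)"
        using g x e_ix[of \<one>] cocycle_one[OF g] e_eq_iff[OF g x] by simp
      also have "\<dots> = (reg ?g * V) $$ (ix \<one>, 0)"
        using mat_mult_entry[OF reg_carrier V one k] reg_sum[OF g one] by simp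
      also have "\<dots> = (\<Sum>p<k. Y $$ (ix \<one>,p) * (\<Sum>q<k. ?\<rho> ?g $$ (p,q) * T $$ (q,0)))"
        unfolding eq using mat_mult_entry[OF Y mult_carrier_mat[OF \<rho>c T(1)] one k]
          mat_mult_entry[OF \<rho>c T(1) _ k] by simp
      finally show ?thesis by (simp add: sum_distrib_left mult_ac)
    qed
    have "V *\<^sub>v unit_vec k 0 \<in> S" by (rule VS) simp
    then have "(\<Sum>x<n. cnj (?\<rho> (e x) $$ (p,q)) * (V *\<^sub>v unit_vec k 0) $ x) = 0" if "p < k" "q < k" for p q
      using that kd \<alpha> by (simp add: S_def del: index_mult_mat_vec)
    then have orth: "(\<Sum>x<n. cnj (?\<rho> (e x) $$ (p,q)) * V $$ (x,0)) = 0" if "p < k" "q < k" for p q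
      using that V k by simp
    \<comment> \<open>The squared norm of column 0. Only the conjugated factor is expanded by
      \<open>span\<close>, leaving inner products with coefficients, all of which vanish.\<close>
    have "(1::complex) = (cadj V * V) $$ (0,0)" using iso k by simp
    also have "\<dots> = (\<Sum>x<n. cnj (V $$ (x,0)) * V $$ (x,0))"
      using V k by (subst mat_mult_entry[of _ k n _ k]) (auto simp: cadj_index)
    also have "\<dots> = (\<Sum>x<n. cnj (\<Sum>p<k. \<Sum>q<k. Y $$ (ix \<one>,p) * T $$ (q,0) * ?\<rho> (e x) $$ (p,q)) * V $$ (x,0))"
      using span by (intro sum.cong refl) simp
    also have "\<dots> = (\<Sum>x<n. \<Sum>p<k. \<Sum>q<k. cnj (Y $$ (ix \<one>,p) * T $$ (q,0)) * (cnj (?\<rho> (e x) $$ (p,q)) * V $$ (x,0)))"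
      by (simp add: sum_distrib_right mult.assoc)
    also have "\<dots> = (\<Sum>p<k. \<Sum>q<k. cnj (Y $$ (ix \<one>,p) * T $$ (q,0)) * (\<Sum>x<n. cnj (?\<rho> (e x) $$ (p,q)) * V $$ (x,0)))"
      unfolding sum_distrib_left by (subst sum.swap, rule sum.cong[OF refl], rule sum.swap)
    also have "\<dots> = 0" using orth by simp
    finally show False by simp
  qed
  moreover have "v \<in> S" using v orth by (simp add: S_def)
  ultimately show ?thesis by simp
qed

section \<open>Orthonormal coefficients and the dimension count\<close>

definition coeff :: "nat \<Rightarrow> nat \<Rightarrow> nat \<Rightarrow> 'a \<Rightarrow> complex" where
  "coeff \<alpha> i j g = of_real (sqrt (real (ds ! \<alpha>) / real n)) * (reps ! \<alpha>) g $$ (i,j)"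

text \<open>The square root in \<open>coeff\<close> is chosen against the value |G| / d in Schur
  orthogonality; coefficients of different blocks are orthogonal by inequivalence.\<close>

lemma coeff_orthonormal:
  assumes "\<alpha> < length ds" "i < ds ! \<alpha>" "j < ds ! \<alpha>" and "\<beta> < length ds" "k < ds ! \<beta>" "l < ds ! \<beta>"
  shows "(\<Sum>g\<in>carrier G. coeff \<alpha> i j g * cnj (coeff \<beta> k l g))
    = (if (\<alpha>,i,j) = (\<beta>,k,l) then 1 else 0)"
proof -
  have *: "(\<Sum>g\<in>carrier G. coeff \<alpha> i j g * cnj (coeff \<beta> k l g))
    = of_real (sqrt (real (ds ! \<alpha>) / real n) * sqrt (real (ds ! \<beta>) / real n)) *
      (\<Sum>g\<in>carrier G. (reps ! \<alpha>) g $$ (i,j) * cnj ((reps ! \<beta>) g $$ (k,l)))"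
    by (simp add: coeff_def sum_distrib_left mult_ac)
  show ?thesis
  proof (cases "\<alpha> = \<beta>")
    case True
    have "(\<Sum>g\<in>carrier G. coeff \<alpha> i j g * cnj (coeff \<beta> k l g))
      = of_real (real (ds ! \<alpha>) / real n) * (if i = k \<and> j = l then of_nat n / of_nat (ds ! \<alpha>) else 0)"
      unfolding * using True assms schur_orthogonality[OF irrep[OF assms(1)], of i j k l]
      by (simp only: real_sqrt_mult_self) simp
    then show ?thesis using True n_pos ds_pos[OF assms(1)] by auto
  next
    case False
    then have "\<not> equiv_proj_rep G (ds ! \<beta>) (reps ! \<beta>) (ds ! \<alpha>) (reps ! \<alpha>)"
      using complete assms by (auto simp: complete_irrep_system_def)
    then show ?thesis
      unfolding * using False schur_orthogonality_inequiv[OF irrep[OF assms(1)] irrep[OF assms(4)]] assms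
      by simp
  qed
qed

text \<open>Orthonormality bounds the number N of coefficients by |G|, and completeness gives the
  reverse bound. The equality makes the transforms below square and matches the number of block
  entries with the number of Gaussian variables.\<close>

lemma sum_squares_dims: "(\<Sum>\<alpha><length ds. (ds ! \<alpha>)\<^sup>2) = n"
proof -
  define I where "I = (SIGMA \<alpha>:{..<length ds}. {..<ds ! \<alpha>} \<times> {..<ds ! \<alpha>})"
  define N where "N = card I"
  have fin: "finite I" by (simp add: I_def)
  obtain b where b: "bij_betw b {..<N} I"
    using ex_bij_betw_nat_finite[OF fin] by (auto simp: N_def atLeast0LessThan)
  \<comment> \<open>The rows are conjugated so that A applied to v lists the inner products tested
    in \<open>orthogonal_to_coeffs_eq_0\<close>.\<close>
  define A where "A = mat N n (\<lambda>(r,x). case b r of (\<alpha>,i,j) \<Rightarrow> cnj (coeff \<alpha> i j (e x)))"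
  have A: "A \<in> carrier_mat N n" by (simp add: A_def)
  then have A': "cadj A \<in> carrier_mat n N" by simp
  have AA: "A * cadj A = 1\<^sub>m N"
  proof (rule eq_matI)
    fix r s assume "r < dim_row (1\<^sub>m N :: complex mat)" "s < dim_col (1\<^sub>m N :: complex mat)"
    then have rs: "r < N" "s < N" by auto
    obtain \<alpha> i j \<beta> k l where br: "b r = (\<alpha>,i,j)" and bs: "b s = (\<beta>,k,l)" by (metis prod_cases3)
    have "b r \<in> I" "b s \<in> I" using b rs by (auto simp: bij_betw_def)
    then have mem: "\<alpha> < length ds" "i < ds ! \<alpha>" "j < ds ! \<alpha>" "\<beta> < length ds" "k < ds ! \<beta>" "l < ds ! \<beta>"
      using br bs by (auto simp: I_def)
    have "(A * cadj A) $$ (r,s) = (\<Sum>x<n. coeff \<beta> k l (e x) * cnj (coeff \<alpha> i j (e x)))"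
      using rs A br bs by (subst mat_mult_entry[OF A A']) (auto simp: cadj_index A_def mult.commute intro!: sum.cong)
    also have "\<dots> = (\<Sum>g\<in>carrier G. coeff \<beta> k l g * cnj (coeff \<alpha> i j g))" by (rule sum_enum)
    also have "\<dots> = (if b s = b r then 1 else 0)" using coeff_orthonormal[OF mem(4-6,1-3)] br bs by simp
    also have "\<dots> = (if r = s then 1 else 0)" using b rs by (auto simp: bij_betw_def dest: inj_onD)
    finally show "(A * cadj A) $$ (r,s) = 1\<^sub>m N $$ (r,s)" using rs by simp
  qed (use A in auto)
  \<comment> \<open>The projection onto the complement of the span of the coefficients:
    \<open>A * P = 0\<close> says that every column of P is orthogonal to all of them, so P
    vanishes.\<close>
  define P where "P = 1\<^sub>m n - cadj A * A"
  have Q: "cadj A * A \<in> carrier_mat n n" using A A' by auto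
  then have P: "P \<in> carrier_mat n n" unfolding P_def by (rule minus_carrier_mat)
  have "A * P = A * 1\<^sub>m n - A * (cadj A * A)"
    unfolding P_def by (rule mult_minus_distrib_mat[OF A _ Q]) simp
  also have "A * (cadj A * A) = A"
    using assoc_mult_mat[OF A A' A] AA A by simp
  finally have AP: "A * P = 0\<^sub>m N n" using A by simp
  have "col P y = 0\<^sub>v n" if y: "y < n" for y
  proof (rule orthogonal_to_coeffs_eq_0)
    show "col P y \<in> carrier_vec n" by (rule carrier_vecI) (use P in simp)
    fix \<alpha> i j assume \<alpha>: "\<alpha> < length ds" "i < ds ! \<alpha>" "j < ds ! \<alpha>"
    then have "(\<alpha>,i,j) \<in> I" by (simp add: I_def)
    then obtain r where r: "r < N" "b r = (\<alpha>,i,j)" using b by (auto simp: bij_betw_def)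
    have "0 = (A * P) $$ (r,y)" using AP r y by simp
    also have "\<dots> = (\<Sum>x<n. cnj (coeff \<alpha> i j (e x)) * P $$ (x,y))"
      using r y by (subst mat_mult_entry[OF A P]) (auto simp: A_def)
    also have "\<dots> = of_real (sqrt (real (ds ! \<alpha>) / real n)) *
        (\<Sum>x<n. cnj ((reps ! \<alpha>) (e x) $$ (i,j)) * P $$ (x,y))"
      by (simp add: coeff_def sum_distrib_left mult_ac)
    finally show "(\<Sum>x<n. cnj ((reps ! \<alpha>) (e x) $$ (i,j)) * col P y $ x) = 0"
      using P y n_pos ds_pos[OF \<alpha>(1)] by simp
  qed
  then have P0: "P $$ (x,y) = 0" if "x < n" "y < n" for x y
    using that P by (metis carrier_matD(1) carrier_matD(2) index_col index_zero_vec(1))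
  have "cadj A * A = 1\<^sub>m n"
  proof (rule eq_matI)
    fix x y assume "x < dim_row (1\<^sub>m n :: complex mat)" "y < dim_col (1\<^sub>m n :: complex mat)"
    then have xy: "x < n" "y < n" by auto
    have "P $$ (x,y) = 1\<^sub>m n $$ (x,y) - (cadj A * A) $$ (x,y)"
      unfolding P_def using xy Q by (intro index_minus_mat) auto
    then show "(cadj A * A) $$ (x,y) = 1\<^sub>m n $$ (x,y)" using P0[OF xy] by simp
  qed (use A in auto)
  then have "N = n"
    using left_inverse_dim_le[OF A A' AA] left_inverse_dim_le[OF A' A] by simp
  moreover have "N = (\<Sum>\<alpha><length ds. (ds ! \<alpha>)\<^sup>2)"
    unfolding N_def I_def by (simp add: power2_eq_square)
  ultimately show ?thesis by simp
qed

end

section \<open>Unitary invariance of Gaussian families\<close>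

text \<open>A product measure is determined by its values on boxes, and a coordinatewise map pulls
  boxes back to boxes. It will be applied to translations.\<close>

lemma (in product_sigma_finite) distr_PiM_componentwise:
  assumes I: "finite I" and f: "\<And>i. i \<in> I \<Longrightarrow> f i \<in> measurable (M i) (M i)"
    and inv: "\<And>i. i \<in> I \<Longrightarrow> distr (M i) (M i) (f i) = M i"
  shows "distr (PiM I M) (PiM I M) (\<lambda>x. \<lambda>i\<in>I. f i (x i)) = PiM I M"
proof (rule PiM_eqI[OF I])
  interpret finite_product_sigma_finite M I by standard fact
  note f[measurable]
  have meas: "(\<lambda>x. \<lambda>i\<in>I. f i (x i)) \<in> measurable (PiM I M) (PiM I M)"
    by measurable
  fix A assume A: "\<And>i. i \<in> I \<Longrightarrow> A i \<in> sets (M i)"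
  have A': "f i -` A i \<inter> space (M i) \<in> sets (M i)" if "i \<in> I" for i
    using f[OF that] A[OF that] by (rule measurable_sets)
  have "emeasure (distr (PiM I M) (PiM I M) (\<lambda>x. \<lambda>i\<in>I. f i (x i))) (Pi\<^sub>E I A)
      = emeasure (PiM I M) ((\<lambda>x. \<lambda>i\<in>I. f i (x i)) -` Pi\<^sub>E I A \<inter> space (PiM I M))"
    using meas A I by (intro emeasure_distr) auto
  also have "(\<lambda>x. \<lambda>i\<in>I. f i (x i)) -` Pi\<^sub>E I A \<inter> space (PiM I M) = Pi\<^sub>E I (\<lambda>i. f i -` A i \<inter> space (M i))"
    by (auto simp: space_PiM PiE_iff)
  also have "emeasure (PiM I M) \<dots> = (\<Prod>i\<in>I. emeasure (M i) (f i -` A i \<inter> space (M i)))"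
    using A' I by (intro emeasure_PiM) auto
  also have "\<dots> = (\<Prod>i\<in>I. emeasure (distr (M i) (M i) (f i)) (A i))"
    using A f by (intro prod.cong refl) (simp add: emeasure_distr)
  finally show "emeasure (distr (PiM I M) (PiM I M) (\<lambda>x. \<lambda>i\<in>I. f i (x i))) (Pi\<^sub>E I A)
      = (\<Prod>i\<in>I. emeasure (M i) (A i))"
    using inv by (simp cong: prod.cong del: restrict_apply)
qed simp

text \<open>On boxes both the density and the indicator factor. The identity leads from independent
  variables with densities to one joint density and, after the unitary map, back again.\<close>

lemma (in product_sigma_finite) density_PiM_prod:
  assumes I: "finite I" and f[measurable]: "\<And>i. i \<in> I \<Longrightarrow> f i \<in> borel_measurable (M i)"
    and sf: "\<And>i. sigma_finite_measure (density (M i) (f i))"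
  shows "density (PiM I M) (\<lambda>x. \<Prod>i\<in>I. f i (x i)) = PiM I (\<lambda>i. density (M i) (f i))"
proof (rule product_sigma_finite.PiM_eqI[OF _ I])
  show "product_sigma_finite (\<lambda>i. density (M i) (f i))" using sf by (simp add: product_sigma_finite_def)
  show "sets (density (PiM I M) (\<lambda>x. \<Prod>i\<in>I. f i (x i))) = sets (PiM I (\<lambda>i. density (M i) (f i)))"
    by (simp cong: sets_PiM_cong)
  fix A assume "\<And>i. i \<in> I \<Longrightarrow> A i \<in> sets (density (M i) (f i))"
  then have A[measurable]: "\<And>i. i \<in> I \<Longrightarrow> A i \<in> sets (M i)" by simp
  have "emeasure (density (PiM I M) (\<lambda>x. \<Prod>i\<in>I. f i (x i))) (Pi\<^sub>E I A)
      = (\<integral>\<^sup>+x. (\<Prod>i\<in>I. f i (x i)) * indicator (Pi\<^sub>E I A) x \<partial>PiM I M)"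
    using I A by (intro emeasure_density) auto
  also have "\<dots> = (\<integral>\<^sup>+x. (\<Prod>i\<in>I. f i (x i) * indicator (A i) (x i)) \<partial>PiM I M)"
  proof (rule nn_integral_cong)
    fix x assume "x \<in> space (PiM I M)"
    then have ext: "x \<in> extensional I" by (simp add: space_PiM PiE_iff)
    show "(\<Prod>i\<in>I. f i (x i)) * indicator (Pi\<^sub>E I A) x = (\<Prod>i\<in>I. f i (x i) * indicator (A i) (x i))"
    proof (cases "x \<in> Pi\<^sub>E I A")
      case True
      then show ?thesis by (auto simp: PiE_iff intro!: prod.cong)
    next
      case False
      \<comment> \<open>As x is extensional, leaving the box means that a coordinate in I leaves its
        side, and that factor is zero.\<close>
      then obtain i where "i \<in> I" "x i \<notin> A i" using ext by (auto simp: PiE_iff)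
      then have "(\<Prod>i\<in>I. f i (x i) * indicator (A i) (x i)) = 0"
        using I by (intro prod_zero bexI[of _ i]) auto
      then show ?thesis using False by simp
    qed
  qed
  also have "\<dots> = (\<Prod>i\<in>I. \<integral>\<^sup>+x. f i x * indicator (A i) x \<partial>M i)"
    using I by (intro product_nn_integral_prod) auto
  also have "\<dots> = (\<Prod>i\<in>I. emeasure (density (M i) (f i)) (A i))"
    by (intro prod.cong refl) (simp add: emeasure_density)
  finally show "emeasure (density (PiM I M) (\<lambda>x. \<Prod>i\<in>I. f i (x i))) (Pi\<^sub>E I A)
      = (\<Prod>i\<in>I. emeasure (density (M i) (f i)) (A i))" .
qed

section \<open>Gaussian weights and translation invariance\<close>

abbreviation lborel_PiM :: "'i set \<Rightarrow> ('i \<Rightarrow> complex) measure" where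
  "lborel_PiM I \<equiv> PiM I (\<lambda>_. lborel)"

definition gaussian_weight :: "'i set \<Rightarrow> ('i \<Rightarrow> complex) \<Rightarrow> ennreal" where
  "gaussian_weight I x = (\<Prod>i\<in>I. std_complex_gaussian_density (x i))"

lemma gaussian_density_measurable [measurable]: "std_complex_gaussian_density \<in> borel_measurable borel"
  unfolding std_complex_gaussian_density_def by measurable

lemma gaussian_weight_measurable [measurable]: "gaussian_weight I \<in> borel_measurable (lborel_PiM I)"
  unfolding gaussian_weight_def by measurable

text \<open>The weight depends only on the sum of squared moduli and on \<open>card I\<close>. Hence
  it is preserved by norm-preserving maps between index sets of equal size.\<close>

lemma gaussian_weight_eq:
  assumes "finite I"
  shows "gaussian_weight I x = ennreal (exp (- (\<Sum>i\<in>I. (cmod (x i))\<^sup>2)) / pi ^ card I)"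
proof -
  have "gaussian_weight I x = ennreal (\<Prod>i\<in>I. exp (- (cmod (x i))\<^sup>2) / pi)"
    unfolding gaussian_weight_def std_complex_gaussian_density_def by (subst prod_ennreal) auto
  also have "(\<Prod>i\<in>I. exp (- (cmod (x i))\<^sup>2) / pi) = exp (- (\<Sum>i\<in>I. (cmod (x i))\<^sup>2)) / pi ^ card I"
    using assms by (simp add: prod_dividef exp_sum flip: sum_negf)
  finally show ?thesis .
qed

lemma nn_integral_lborel_PiM_translate:
  assumes I: "finite I" and F: "F \<in> borel_measurable (lborel_PiM I)"
  shows "(\<integral>\<^sup>+x. F (\<lambda>i\<in>I. a i + x i) \<partial>lborel_PiM I) = (\<integral>\<^sup>+x. F x \<partial>lborel_PiM I)"
proof -
  interpret product_sigma_finite "\<lambda>_. lborel :: complex measure" ..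
  have "distr lborel lborel (\<lambda>x. a i + x) = lborel" for i
    using lborel_distr_plus[of "a i"] by (simp cong: distr_cong)
  then have *: "distr (lborel_PiM I) (lborel_PiM I) (\<lambda>x. \<lambda>i\<in>I. a i + x i) = lborel_PiM I"
    using I by (intro distr_PiM_componentwise) auto
  have "(\<integral>\<^sup>+x. F x \<partial>distr (lborel_PiM I) (lborel_PiM I) (\<lambda>x. \<lambda>i\<in>I. a i + x i))
      = (\<integral>\<^sup>+x. F (\<lambda>i\<in>I. a i + x i) \<partial>lborel_PiM I)"
    using F by (intro nn_integral_distr) simp_all
  then show ?thesis unfolding * by simp
qed

text \<open>A unitary matrix whose rows and columns have different index types. The relation
  \<open>cols\<close> makes the map norm-preserving, while \<open>rows\<close> makes the adjoint a
  right inverse.\<close>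

locale unitary_family =
  fixes J :: "'j set" and K :: "'k set" and U :: "'j \<Rightarrow> 'k \<Rightarrow> complex"
  assumes finJ: "finite J" and finK: "finite K" and card_eq: "card J = card K"
    and rows: "\<And>i i'. i \<in> J \<Longrightarrow> i' \<in> J \<Longrightarrow> (\<Sum>k\<in>K. U i k * cnj (U i' k)) = (if i = i' then 1 else 0)"
    and cols: "\<And>k k'. k \<in> K \<Longrightarrow> k' \<in> K \<Longrightarrow> (\<Sum>i\<in>J. cnj (U i k) * U i k') = (if k = k' then 1 else 0)"
begin

definition T :: "('k \<Rightarrow> complex) \<Rightarrow> 'j \<Rightarrow> complex" where
  "T x = (\<lambda>i\<in>J. \<Sum>k\<in>K. U i k * x k)"

lemma T_measurable [measurable]: "T \<in> measurable (lborel_PiM K) (lborel_PiM J)"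
  unfolding T_def by measurable

lemma sum_cmod_T: "(\<Sum>i\<in>J. (cmod (T x i))\<^sup>2) = (\<Sum>k\<in>K. (cmod (x k))\<^sup>2)"
proof -
  have "complex_of_real (\<Sum>i\<in>J. (cmod (T x i))\<^sup>2)
      = (\<Sum>i\<in>J. (\<Sum>k\<in>K. U i k * x k) * (\<Sum>k'\<in>K. cnj (U i k') * cnj (x k')))"
    by (simp add: T_def complex_norm_square del: of_real_power)
  also have "\<dots> = (\<Sum>i\<in>J. \<Sum>k\<in>K. \<Sum>k'\<in>K. (cnj (U i k') * U i k) * (x k * cnj (x k')))"
    by (simp add: sum_product mult_ac)
  also have "\<dots> = (\<Sum>k\<in>K. \<Sum>k'\<in>K. (\<Sum>i\<in>J. cnj (U i k') * U i k) * (x k * cnj (x k')))"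
    by (subst sum.swap, intro sum.cong refl, subst sum.swap) (simp add: sum_distrib_right)
  also have "\<dots> = (\<Sum>k\<in>K. \<Sum>k'\<in>K. if k' = k then x k * cnj (x k') else 0)"
    by (intro sum.cong refl) (simp add: cols)
  also have "\<dots> = (\<Sum>k\<in>K. x k * cnj (x k))"
    using finK by (intro sum.cong) (auto simp: sum.delta)
  also have "\<dots> = complex_of_real (\<Sum>k\<in>K. (cmod (x k))\<^sup>2)"
    by (simp add: complex_norm_square del: of_real_power)
  finally show ?thesis by (simp only: of_real_eq_iff)
qed

lemma gaussian_weight_T: "gaussian_weight J (T x) = gaussian_weight K x"
  using finJ finK by (simp add: gaussian_weight_eq sum_cmod_T card_eq)

text \<open>The source is shifted by the adjoint of U applied to y, and U maps this shift back to y
  by \<open>rows\<close>. Thus every translation of the target lifts to one of the source.\<close>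

lemma T_translate:
  assumes i: "i \<in> J"
  shows "T (\<lambda>k\<in>K. (\<Sum>j\<in>J. cnj (U j k) * y j) + x k) i = y i + T x i"
proof -
  have "(\<Sum>k\<in>K. U i k * (\<Sum>j\<in>J. cnj (U j k) * y j)) = (\<Sum>j\<in>J. (\<Sum>k\<in>K. U i k * cnj (U j k)) * y j)"
    by (simp add: sum_distrib_left sum_distrib_right mult.assoc, rule sum.swap)
  also have "\<dots> = (\<Sum>j\<in>J. if i = j then y j else 0)"
    using i by (intro sum.cong refl) (simp add: rows)
  also have "\<dots> = y i" using i finJ by simp
  finally show ?thesis using i by (simp add: T_def distrib_left sum.distrib)
qed

text \<open>The uniqueness proof for Haar measure: by Fubini and translation invariance, the image of
  Lebesgue measure under \<open>T\<close> is proportional to Lebesgue measure, and integrating the Gaussian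
  weight, which \<open>T\<close> preserves, shows that the constant is \<open>1\<close>.\<close>

lemma distr_T:
  assumes "prob_space (density lborel std_complex_gaussian_density)"
  shows "distr (lborel_PiM K) (lborel_PiM J) T = lborel_PiM J"
proof (rule measure_eqI)
  interpret product_sigma_finite "\<lambda>_. lborel :: complex measure" ..
  interpret mu: finite_product_sigma_finite "\<lambda>_. lborel :: complex measure" K by standard (rule finK)
  interpret nu: finite_product_sigma_finite "\<lambda>_. lborel :: complex measure" J by standard (rule finJ)
  interpret P: pair_sigma_finite "lborel_PiM K" "lborel_PiM J" ..
  interpret g: prob_space "density lborel std_complex_gaussian_density" by fact
  have "integral\<^sup>N lborel std_complex_gaussian_density = 1"
    using g.emeasure_space_1 by (simp add: emeasure_density)
  then have total: "integral\<^sup>N (lborel_PiM J) (gaussian_weight J) = 1"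
      "integral\<^sup>N (lborel_PiM K) (gaussian_weight K) = 1"
    unfolding gaussian_weight_def using product_nn_integral_prod[OF finJ, of "\<lambda>_. std_complex_gaussian_density"]
      product_nn_integral_prod[OF finK, of "\<lambda>_. std_complex_gaussian_density"] by simp_all
  fix A assume "A \<in> sets (distr (lborel_PiM K) (lborel_PiM J) T)"
  then have A[measurable]: "A \<in> sets (lborel_PiM J)" by simp
  let ?f = "indicator A :: _ \<Rightarrow> ennreal" and ?g = "gaussian_weight J"
  let ?m = "lborel_PiM K" and ?n = "lborel_PiM J"
  have restr: "(\<lambda>i\<in>J. y i) = y" if "y \<in> space ?n" for y
    using that by (auto simp: space_PiM PiE_iff extensional_restrict)
  have Text: "(\<lambda>i\<in>J. T x i) = T x" for x by (auto simp: T_def)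
  have [measurable]: "(\<lambda>p. T (fst p) i) \<in> borel_measurable (?m \<Otimes>\<^sub>M ?n)"
      "(\<lambda>p. snd p i) \<in> borel_measurable (?m \<Otimes>\<^sub>M ?n)" if "i \<in> J" for i
  proof -
    have "(\<lambda>x. T x i) \<in> borel_measurable ?m" "(\<lambda>y. y i) \<in> borel_measurable ?n"
      using that by (simp_all add: T_def)
    then show "(\<lambda>p. T (fst p) i) \<in> borel_measurable (?m \<Otimes>\<^sub>M ?n)"
        "(\<lambda>p. snd p i) \<in> borel_measurable (?m \<Otimes>\<^sub>M ?n)"
      by (auto intro: measurable_compose[OF measurable_fst] measurable_compose[OF measurable_snd])
  qed
  \<comment> \<open>The total weight 1 is inserted as a factor; everything stays in
    \<open>ennreal\<close>, so A may have infinite measure.\<close>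
  have "emeasure (distr ?m ?n T) A = (\<integral>\<^sup>+y. ?g y \<partial>?n) * (\<integral>\<^sup>+x. ?f (T x) \<partial>?m)"
    unfolding total by (subst nn_integral_indicator[symmetric], simp, subst nn_integral_distr) auto
  also have "\<dots> = (\<integral>\<^sup>+y. \<integral>\<^sup>+x. ?g y * ?f (T x) \<partial>?m \<partial>?n)"
    by (simp add: nn_integral_cmult nn_integral_multc)
  \<comment> \<open>For fixed y, translating x by the adjoint of U applied to y replaces
    \<open>T x\<close> by \<open>T x + y\<close>.\<close>
  also have "\<dots> = (\<integral>\<^sup>+y. \<integral>\<^sup>+x. ?g y * ?f (\<lambda>i\<in>J. T x i + y i) \<partial>?m \<partial>?n)"
  proof (rule nn_integral_cong)
    fix y assume y: "y \<in> space ?n"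
    let ?a = "\<lambda>k. \<Sum>j\<in>J. cnj (U j k) * y j"
    have "(\<integral>\<^sup>+x. ?g y * ?f (T x) \<partial>?m) = (\<integral>\<^sup>+x. ?g y * ?f (T (\<lambda>k\<in>K. ?a k + x k)) \<partial>?m)"
      by (rule nn_integral_lborel_PiM_translate[OF finK, symmetric]) measurable
    also have "\<dots> = (\<integral>\<^sup>+x. ?g y * ?f (\<lambda>i\<in>J. T x i + y i) \<partial>?m)"
    proof -
      have "T (\<lambda>k\<in>K. ?a k + x k) = (\<lambda>i\<in>J. T x i + y i)" for x
        using T_translate[of _ y x] by (subst Text[symmetric]) (auto simp: fun_eq_iff)
      then show ?thesis by (simp only:)
    qed
    finally show "(\<integral>\<^sup>+x. ?g y * ?f (T x) \<partial>?m) = (\<integral>\<^sup>+x. ?g y * ?f (\<lambda>i\<in>J. T x i + y i) \<partial>?m)" .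
  qed
  also have "\<dots> = (\<integral>\<^sup>+x. \<integral>\<^sup>+y. ?g y * ?f (\<lambda>i\<in>J. T x i + y i) \<partial>?n \<partial>?m)"
    by (rule P.Fubini') measurable
  \<comment> \<open>For fixed x, translating y by \<open>- T x\<close> frees the indicator from
    x.\<close>
  also have "\<dots> = (\<integral>\<^sup>+x. \<integral>\<^sup>+y. ?g (\<lambda>i\<in>J. - T x i + y i) * ?f y \<partial>?n \<partial>?m)"
  proof (rule nn_integral_cong)
    fix x assume "x \<in> space ?m"
    then have [measurable]: "T x \<in> space ?n" using measurable_space[OF T_measurable] by blast
    have "(\<integral>\<^sup>+y. ?g y * ?f (\<lambda>i\<in>J. T x i + y i) \<partial>?n)
      = (\<integral>\<^sup>+y. ?g (\<lambda>i\<in>J. - T x i + y i) * ?f (\<lambda>i\<in>J. T x i + (\<lambda>i\<in>J. - T x i + y i) i) \<partial>?n)"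
      by (rule nn_integral_lborel_PiM_translate[OF finJ, symmetric]) measurable
    also have "\<dots> = (\<integral>\<^sup>+y. ?g (\<lambda>i\<in>J. - T x i + y i) * ?f y \<partial>?n)"
    proof (rule nn_integral_cong)
      fix y assume "y \<in> space ?n"
      then have "(\<lambda>i\<in>J. T x i + (\<lambda>i\<in>J. - T x i + y i) i) = y"
        by (subst restr[symmetric]) (auto simp: fun_eq_iff)
      then show "?g (\<lambda>i\<in>J. - T x i + y i) * ?f (\<lambda>i\<in>J. T x i + (\<lambda>i\<in>J. - T x i + y i) i)
          = ?g (\<lambda>i\<in>J. - T x i + y i) * ?f y" by simp
    qed
    finally show "(\<integral>\<^sup>+y. ?g y * ?f (\<lambda>i\<in>J. T x i + y i) \<partial>?n)
      = (\<integral>\<^sup>+y. ?g (\<lambda>i\<in>J. - T x i + y i) * ?f y \<partial>?n)" .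
  qed
  also have "\<dots> = (\<integral>\<^sup>+y. \<integral>\<^sup>+x. ?g (\<lambda>i\<in>J. - T x i + y i) * ?f y \<partial>?m \<partial>?n)"
    by (rule P.Fubini'[symmetric]) measurable
  also have "\<dots> = (\<integral>\<^sup>+y. ?f y \<partial>?n)"
  proof (rule nn_integral_cong)
    fix y assume y: "y \<in> space ?n"
    let ?a = "\<lambda>k. \<Sum>j\<in>J. cnj (U j k) * (- y j)"
    \<comment> \<open>The weight is even, so y - T x may be replaced by T of x shifted by the
      adjoint of U applied to -y. Invariance under \<open>T\<close> and under translations then
      integrates the weight over x to 1.\<close>
    have even: "?g (\<lambda>i\<in>J. - T x i + y i) = ?g (T (\<lambda>k\<in>K. ?a k + x k))" for x
    proof -
      have "T (\<lambda>k\<in>K. ?a k + x k) i = - (- T x i + y i)" if "i \<in> J" for i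
        using T_translate[OF that, of "\<lambda>j. - y j" x] by simp
      then have "(\<Sum>i\<in>J. (cmod ((\<lambda>i\<in>J. - T x i + y i) i))\<^sup>2) = (\<Sum>i\<in>J. (cmod (T (\<lambda>k\<in>K. ?a k + x k) i))\<^sup>2)"
        by (intro sum.cong refl) (simp only: norm_minus_cancel restrict_apply')
      then show ?thesis using finJ by (simp only: gaussian_weight_eq)
    qed
    have "(\<integral>\<^sup>+x. ?g (\<lambda>i\<in>J. - T x i + y i) * ?f y \<partial>?m) = (\<integral>\<^sup>+x. gaussian_weight K (\<lambda>k\<in>K. ?a k + x k) * ?f y \<partial>?m)"
      by (simp only: even gaussian_weight_T)
    also have "\<dots> = (\<integral>\<^sup>+x. gaussian_weight K x * ?f y \<partial>?m)"
      by (rule nn_integral_lborel_PiM_translate[OF finK]) measurable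
    also have "\<dots> = ?f y" by (simp add: nn_integral_multc total)
    finally show "(\<integral>\<^sup>+x. ?g (\<lambda>i\<in>J. - T x i + y i) * ?f y \<partial>?m) = ?f y" .
  qed
  also have "\<dots> = emeasure ?n A" by simp
  finally show "emeasure (distr ?m ?n T) A = emeasure ?n A" .
qed simp

end

text \<open>Independence and the marginal laws together say that the joint law has density
  \<open>gaussian_weight\<close> with respect to product Lebesgue measure. This law is pushed
  through \<open>T\<close>, and both properties are read off again on the other side.\<close>

lemma gaussian_family_unitary:
  fixes c :: "'k \<Rightarrow> 's \<Rightarrow> complex"
  assumes "unitary_family J K U" and "prob_space M" and ne: "K \<noteq> {}"
    and indep: "prob_space.indep_vars M (\<lambda>_. borel) c K"
    and gauss: "\<And>k. k \<in> K \<Longrightarrow> distributed M lborel (c k) std_complex_gaussian_density"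
  shows "prob_space.indep_vars M (\<lambda>_. borel) (\<lambda>i x. \<Sum>k\<in>K. U i k * c k x) J"
    and "\<And>i. i \<in> J \<Longrightarrow> distributed M lborel (\<lambda>x. \<Sum>k\<in>K. U i k * c k x) std_complex_gaussian_density"
proof -
  interpret unitary_family J K U by fact
  interpret prob_space M by fact
  interpret product_sigma_finite "\<lambda>_. lborel :: complex measure" ..
  let ?D = "density lborel std_complex_gaussian_density"
  define Z where "Z i x = (\<Sum>k\<in>K. U i k * c k x)" for i x
  have rv[measurable]: "c k \<in> borel_measurable M" if "k \<in> K" for k
    using gauss[OF that] by (simp add: distributed_def)
  have law: "distr M borel (c k) = ?D" if "k \<in> K" for k
    using gauss[OF that] by (simp add: distributed_def cong: distr_cong)
  \<comment> \<open>That the Gaussian density has total mass 1 is inferred from the data: it is the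
    density of the law of some \<open>c k\<close>, as K is nonempty.\<close>
  have D: "prob_space ?D"
    using ne law rv by (metis prob_space_distr equals0I)
  then have Dsf: "sigma_finite_measure ?D"
    by (simp add: prob_space_imp_sigma_finite)
  have Z[measurable]: "Z i \<in> borel_measurable M" for i unfolding Z_def by measurable
  have J: "J \<noteq> {}" using card_eq finJ finK ne by auto
  have sets_eq: "sets (lborel_PiM I) = sets (PiM I (\<lambda>_. borel))" for I :: "'i set"
    by (intro sets_PiM_cong) auto
  have "distr M (lborel_PiM K) (\<lambda>x. \<lambda>k\<in>K. c k x) = distr M (PiM K (\<lambda>_. borel)) (\<lambda>x. \<lambda>k\<in>K. c k x)"
    by (intro distr_cong sets_eq refl)
  also have "\<dots> = PiM K (\<lambda>k. distr M borel (c k))"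
    using indep indep_vars_iff_distr_eq_PiM'[of K c "\<lambda>_. borel"] ne rv by blast
  also have "\<dots> = PiM K (\<lambda>_. ?D)" by (intro PiM_cong refl law)
  also have "\<dots> = density (lborel_PiM K) (gaussian_weight K)"
    unfolding gaussian_weight_def using finK Dsf by (intro density_PiM_prod[symmetric]) auto
  finally have joint: "distr M (lborel_PiM K) (\<lambda>x. \<lambda>k\<in>K. c k x) = density (lborel_PiM K) (gaussian_weight K)" .
  have "distr M (lborel_PiM J) (\<lambda>x. \<lambda>i\<in>J. Z i x) = distr M (lborel_PiM J) (T \<circ> (\<lambda>x. \<lambda>k\<in>K. c k x))"
    by (intro distr_cong refl) (auto simp: T_def Z_def)
  also have "\<dots> = distr (distr M (lborel_PiM K) (\<lambda>x. \<lambda>k\<in>K. c k x)) (lborel_PiM J) T"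
    by (rule distr_distr[symmetric]) measurable
  \<comment> \<open>Written as a function of \<open>T x\<close>, the density can pass to the image
    measure.\<close>
  also have "\<dots> = distr (density (lborel_PiM K) (\<lambda>x. gaussian_weight J (T x))) (lborel_PiM J) T"
    unfolding joint gaussian_weight_T ..
  also have "\<dots> = density (distr (lborel_PiM K) (lborel_PiM J) T) (gaussian_weight J)"
    by (rule density_distr[symmetric]) measurable
  also have "\<dots> = density (lborel_PiM J) (gaussian_weight J)" by (simp only: distr_T[OF D])
  also have "\<dots> = PiM J (\<lambda>_. ?D)"
    unfolding gaussian_weight_def using finJ Dsf by (intro density_PiM_prod) auto
  finally have jointZ: "distr M (lborel_PiM J) (\<lambda>x. \<lambda>i\<in>J. Z i x) = PiM J (\<lambda>_. ?D)" .
  have lawZ: "distr M borel (Z i) = ?D" if i: "i \<in> J" for i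
  proof -
    \<comment> \<open>A single law is a coordinate projection of the joint law, a product of
      probability measures.\<close>
    have "distr M borel (Z i) = distr M ?D ((\<lambda>\<omega>. \<omega> i) \<circ> (\<lambda>x. \<lambda>i\<in>J. Z i x))"
      using i by (intro distr_cong) auto
    also have "\<dots> = distr (distr M (lborel_PiM J) (\<lambda>x. \<lambda>i\<in>J. Z i x)) ?D (\<lambda>\<omega>. \<omega> i)"
      using i by (intro distr_distr[symmetric]) (auto intro!: measurable_component_singleton)
    also have "\<dots> = ?D" unfolding jointZ by (rule distr_PiM_component) (use D i in auto)
    finally show ?thesis .
  qed
  have "distr M (PiM J (\<lambda>_. borel)) (\<lambda>x. \<lambda>i\<in>J. Z i x) = PiM J (\<lambda>i. distr M borel (Z i))"
  proof -
    have "distr M (PiM J (\<lambda>_. borel)) (\<lambda>x. \<lambda>i\<in>J. Z i x) = distr M (lborel_PiM J) (\<lambda>x. \<lambda>i\<in>J. Z i x)"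
      by (intro distr_cong sets_eq[symmetric] refl)
    also have "\<dots> = PiM J (\<lambda>i. distr M borel (Z i))"
      unfolding jointZ by (intro PiM_cong refl lawZ[symmetric])
    finally show ?thesis .
  qed
  then have "indep_vars (\<lambda>_. borel) Z J"
    using indep_vars_iff_distr_eq_PiM'[of J Z "\<lambda>_. borel"] J by simp
  then show "indep_vars (\<lambda>_. borel) (\<lambda>i x. \<Sum>k\<in>K. U i k * c k x) J"
    by (simp add: Z_def[abs_def])
  show "distributed M lborel (\<lambda>x. \<Sum>k\<in>K. U i k * c k x) std_complex_gaussian_density" if "i \<in> J" for i
    using lawZ[OF that] Z[of i] unfolding distributed_def Z_def[abs_def]
    by (simp cong: distr_cong)
qed

text \<open>Enumerations of J and K by their common size turn U into a square matrix, for which a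
  right inverse is also a left inverse.\<close>

lemma orthonormal_rows_imp_columns:
  fixes U :: "'j \<Rightarrow> 'k \<Rightarrow> complex"
  assumes J: "finite J" and K: "finite K" and card: "card J = card K"
    and rows: "\<And>i i'. i \<in> J \<Longrightarrow> i' \<in> J \<Longrightarrow> (\<Sum>k\<in>K. U i k * cnj (U i' k)) = (if i = i' then 1 else 0)"
  shows "unitary_family J K U"
proof
  fix k k' assume k: "k \<in> K" "k' \<in> K"
  define N where "N = card K"
  obtain b where b: "bij_betw b {..<N} J"
    using ex_bij_betw_nat_finite[OF J] card by (auto simp: N_def atLeast0LessThan)
  obtain c where c: "bij_betw c {..<N} K"
    using ex_bij_betw_nat_finite[OF K] by (auto simp: N_def atLeast0LessThan)
  define A where "A = mat N N (\<lambda>(r,s). U (b r) (c s))"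
  have A: "A \<in> carrier_mat N N" by (simp add: A_def)
  then have A': "cadj A \<in> carrier_mat N N" by simp
  have "A * cadj A = 1\<^sub>m N"
  proof (rule eq_matI)
    fix r s assume "r < dim_row (1\<^sub>m N :: complex mat)" "s < dim_col (1\<^sub>m N :: complex mat)"
    then have rs: "r < N" "s < N" by auto
    have "(A * cadj A) $$ (r,s) = (\<Sum>x<N. U (b r) (c x) * cnj (U (b s) (c x)))"
      using rs A by (subst mat_mult_entry[OF A A']) (auto simp: cadj_index A_def)
    also have "\<dots> = (\<Sum>k\<in>K. U (b r) k * cnj (U (b s) k))" by (rule sum.reindex_bij_betw[OF c])
    also have "\<dots> = (if b r = b s then 1 else 0)" using rs b by (intro rows) (auto simp: bij_betw_def)
    also have "\<dots> = (if r = s then 1 else 0)" using b rs by (auto simp: bij_betw_def dest: inj_onD)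
    finally show "(A * cadj A) $$ (r,s) = 1\<^sub>m N $$ (r,s)" using rs by simp
  qed (use A in auto)
  then have AA: "cadj A * A = 1\<^sub>m N" by (rule mat_mult_left_right_inverse[OF A A'])
  obtain s s' where s: "s < N" "s' < N" "k = c s" "k' = c s'" using k c by (auto simp: bij_betw_def)
  have "(\<Sum>i\<in>J. cnj (U i k) * U i k') = (\<Sum>r<N. cnj (U (b r) k) * U (b r) k')"
    by (rule sum.reindex_bij_betw[OF b, symmetric])
  also have "\<dots> = (cadj A * A) $$ (s,s')"
    using s A by (subst mat_mult_entry[OF A' A]) (auto simp: cadj_index A_def)
  also have "\<dots> = (if s = s' then 1 else 0)" unfolding AA using s by simp
  also have "\<dots> = (if k = k' then 1 else 0)" using c s by (auto simp: bij_betw_def dest: inj_onD)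
  finally show "(\<Sum>i\<in>J. cnj (U i k) * U i k') = (if k = k' then 1 else 0)" .
qed (use assms in auto)

section \<open>The twisted Fourier transform\<close>

context irrep_system
begin

text \<open>The phase in \<open>W_mat\<close> is the one in the product law of the representation,
  so twisted right translation mixes only the column index of a coefficient. The row index i stays
  fixed; this is the origin of the repetition of each block.\<close>

lemma coeff_mult:
  assumes "\<alpha> < length ds" "i < ds ! \<alpha>" "j < ds ! \<alpha>" "g \<in> carrier G" "h \<in> carrier G"
  shows "\<omega> g h * coeff \<alpha> i j (g \<otimes> h) = (\<Sum>m<ds ! \<alpha>. coeff \<alpha> i m g * (reps ! \<alpha>) h $$ (m,j))"
  using rep_mult_entry[OF irrep_rep[OF assms(1)] assms(4,5,2,3)]
  by (simp add: coeff_def mult.assoc mult.left_commute[of "\<omega> g h"] flip: sum_distrib_left)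

text \<open>A position \<open>r < m * n\<close> with \<open>index m r = (\<alpha>, i, L, j)\<close> lies in block \<open>\<alpha>\<close>, in copy \<open>i\<close> of its
  Kronecker factor, and is entry \<open>L * ds ! \<alpha> + j\<close> of that copy.\<close>

definition sizes :: "nat \<Rightarrow> nat list" where
  "sizes m = map (\<lambda>d. d * (m * d)) ds"

definition index :: "nat \<Rightarrow> nat \<Rightarrow> nat \<times> nat \<times> nat \<times> nat" where
  "index m r = (let (\<alpha>, p) = block_pos (sizes m) r; d = ds ! \<alpha>; q = p mod (m * d)
     in (\<alpha>, p div (m * d), q div d, q mod d))"

text \<open>By the dimension count the blocks exhaust all positions, so \<open>index m\<close>
  numbers a full basis of m copies of the functions on G.\<close>

lemma sum_sizes: "sum_list (sizes m) = m * n"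
proof -
  have "sum_list (sizes m) = (\<Sum>\<alpha><length ds. m * (ds ! \<alpha>)\<^sup>2)"
    by (simp add: sizes_def sum_list_sum_nth atLeast0LessThan power2_eq_square mult_ac)
  then show ?thesis by (simp add: sum_squares_dims flip: sum_distrib_left)
qed

lemma index_range:
  assumes "r < m * n" "index m r = (\<alpha>,i,L,j)"
  shows "\<alpha> < length ds" "i < ds ! \<alpha>" "L < m" "j < ds ! \<alpha>"
proof -
  obtain p where p: "block_pos (sizes m) r = (\<alpha>, p)" "i = p div (m * ds ! \<alpha>)"
      "L = p mod (m * ds ! \<alpha>) div ds ! \<alpha>" "j = p mod (m * ds ! \<alpha>) mod ds ! \<alpha>"
    using assms(2) by (auto simp: index_def Let_def split: prod.splits)
  have "\<alpha> < length ds \<and> p < ds ! \<alpha> * (m * ds ! \<alpha>)"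
    using block_pos_range[of r "sizes m"] assms(1) p(1) by (auto simp: sum_sizes) (auto simp: sizes_def)
  then show "\<alpha> < length ds" "i < ds ! \<alpha>" "L < m" "j < ds ! \<alpha>"
    using p div_less_of_less_mult mod_less_of_less_mult by metis+
qed

lemma index_inj:
  assumes "r < m * n" "r' < m * n"
  shows "index m r = index m r' \<longleftrightarrow> r = r'"
proof
  assume eq: "index m r = index m r'"
  obtain \<alpha> p \<beta> p' where d: "block_pos (sizes m) r = (\<alpha>,p)" "block_pos (sizes m) r' = (\<beta>,p')" by fastforce
  have "\<alpha> = \<beta>" using eq d by (simp add: index_def Let_def)
  then have "p div (m * ds ! \<alpha>) = p' div (m * ds ! \<alpha>)"
      "p mod (m * ds ! \<alpha>) = p' mod (m * ds ! \<alpha>)"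
    using eq d by (auto simp: index_def Let_def) (metis div_mult_mod_eq)
  then have "p = p'" by (metis div_mult_mod_eq)
  then show "r = r'" using block_pos_inj[of r "sizes m" r'] assms d \<open>\<alpha> = \<beta>\<close> by (simp add: sum_sizes)
qed simp

text \<open>The encoding \<open>L * n + a\<close> is that of the rows of \<open>W_mat\<close>, as
  \<open>b * m + R\<close> in \<open>right_fourier\<close> is that of its columns. Only the right
  transform is conjugated, so that the sum over the column group element becomes an inner product of
  coefficients.\<close>

definition left_fourier :: "nat \<Rightarrow> complex mat" where
  "left_fourier m = mat (m * n) (m * n) (\<lambda>(r,y). case index m r of (\<alpha>,i,L,j) \<Rightarrow>
     if L = y div n then coeff \<alpha> i j (e (y mod n)) else 0)"

definition right_fourier :: "nat \<Rightarrow> complex mat" where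
  "right_fourier m = mat (n * m) (n * m) (\<lambda>(y,c). case index m c of (\<alpha>,k,R,l) \<Rightarrow>
     if R = y mod m then cnj (coeff \<alpha> k l (e (y div m))) else 0)"

lemma left_fourier_carrier: "left_fourier m \<in> carrier_mat (m * n) (m * n)"
  by (simp add: left_fourier_def)

lemma right_fourier_carrier: "right_fourier m \<in> carrier_mat (n * m) (n * m)"
  by (simp add: right_fourier_def)

lemma left_fourier_sum:
  assumes r: "r < m * n" and ir: "index m r = (\<alpha>,i,L,j)"
  shows "(\<Sum>y<m * n. left_fourier m $$ (r,y) * f y) = (\<Sum>a<n. coeff \<alpha> i j (e a) * f (L * n + a))"
proof -
  have "(\<Sum>y<m * n. left_fourier m $$ (r,y) * f y)
      = (\<Sum>L'<m. \<Sum>a<n. left_fourier m $$ (r,L' * n + a) * f (L' * n + a))"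
    by (rule sum_div_mod)
  also have "\<dots> = (\<Sum>L'<m. if L' = L then (\<Sum>a<n. coeff \<alpha> i j (e a) * f (L * n + a)) else 0)"
  proof (rule sum.cong[OF refl])
    fix L' assume "L' \<in> {..<m}"
    then have "left_fourier m $$ (r,L' * n + a) = (if L' = L then coeff \<alpha> i j (e a) else 0)" if "a < n" for a
      using r ir that pair_less[of L' m a n] by (simp add: left_fourier_def)
    then show "(\<Sum>a<n. left_fourier m $$ (r,L' * n + a) * f (L' * n + a))
      = (if L' = L then (\<Sum>a<n. coeff \<alpha> i j (e a) * f (L * n + a)) else 0)"
      by simp
  qed
  also have "\<dots> = (\<Sum>a<n. coeff \<alpha> i j (e a) * f (L * n + a))"
    using index_range[OF r ir] by simp
  finally show ?thesis .
qed

lemma right_fourier_sum: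
  assumes c: "c < m * n" and ic: "index m c = (\<alpha>,k,R,l)"
  shows "(\<Sum>y<n * m. f y * right_fourier m $$ (y,c)) = (\<Sum>b<n. f (b * m + R) * cnj (coeff \<alpha> k l (e b)))"
proof -
  have "(\<Sum>y<n * m. f y * right_fourier m $$ (y,c))
      = (\<Sum>b<n. \<Sum>R'<m. f (b * m + R') * right_fourier m $$ (b * m + R',c))"
    by (rule sum_div_mod)
  also have "\<dots> = (\<Sum>b<n. \<Sum>R'<m. if R' = R then f (b * m + R) * cnj (coeff \<alpha> k l (e b)) else 0)"
  proof (intro sum.cong refl)
    fix b R' assume "b \<in> {..<n}" "R' \<in> {..<m}"
    then show "f (b * m + R') * right_fourier m $$ (b * m + R',c)
        = (if R' = R then f (b * m + R) * cnj (coeff \<alpha> k l (e b)) else 0)"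
      using c ic pair_less[of b n R' m] by (simp add: right_fourier_def mult.commute)
  qed
  also have "\<dots> = (\<Sum>b<n. f (b * m + R) * cnj (coeff \<alpha> k l (e b)))"
    using index_range[OF c ic] by simp
  finally show ?thesis .
qed

lemma unitary_left_fourier: "unitary_mat (m * n) (left_fourier m)"
proof -
  let ?U = "left_fourier m"
  have U': "cadj ?U \<in> carrier_mat (m * n) (m * n)" using left_fourier_carrier by simp
  have "?U * cadj ?U = 1\<^sub>m (m * n)"
  proof (rule eq_matI)
    fix r s assume "r < dim_row (1\<^sub>m (m * n) :: complex mat)" "s < dim_col (1\<^sub>m (m * n) :: complex mat)"
    then have rs: "r < m * n" "s < m * n" by auto
    obtain \<alpha> i L j \<beta> k L' l where ir: "index m r = (\<alpha>,i,L,j)" and iy: "index m s = (\<beta>,k,L',l)"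
      by (metis prod_cases4)
    note R = index_range[OF rs(1) ir] and S = index_range[OF rs(2) iy]
    have "(?U * cadj ?U) $$ (r,s) = (\<Sum>y<m * n. ?U $$ (r,y) * cnj (?U $$ (s,y)))"
      using rs left_fourier_carrier[of m]
      by (subst mat_mult_entry[OF left_fourier_carrier U']) (auto simp: cadj_index)
    also have "\<dots> = (\<Sum>a<n. coeff \<alpha> i j (e a) * cnj (?U $$ (s, L * n + a)))"
      by (rule left_fourier_sum[OF rs(1) ir])
    also have "\<dots> = (\<Sum>a<n. if L = L' then coeff \<alpha> i j (e a) * cnj (coeff \<beta> k l (e a)) else 0)"
      using rs iy R pair_less[of L m _ n] by (intro sum.cong refl) (auto simp: left_fourier_def)
    also have "\<dots> = (if L = L' then (\<Sum>g\<in>carrier G. coeff \<alpha> i j g * cnj (coeff \<beta> k l g)) else 0)"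
      using sum_enum[of "\<lambda>g. coeff \<alpha> i j g * cnj (coeff \<beta> k l g)"] by simp
    also have "\<dots> = (if index m r = index m s then 1 else 0)"
      using coeff_orthonormal[OF R(1,2,4) S(1,2,4)] ir iy by auto
    also have "\<dots> = (1\<^sub>m (m * n)) $$ (r,s)" using rs by (simp add: index_inj)
    finally show "(?U * cadj ?U) $$ (r,s) = (1\<^sub>m (m * n)) $$ (r,s)" .
  qed (use left_fourier_carrier[of m] in auto)
  then show ?thesis
    using mat_mult_left_right_inverse[OF left_fourier_carrier U'] left_fourier_carrier
    by (simp add: unitary_mat_def)
qed

lemma unitary_right_fourier: "unitary_mat (n * m) (right_fourier m)"
proof -
  let ?U = "right_fourier m"
  have U': "cadj ?U \<in> carrier_mat (n * m) (n * m)" using right_fourier_carrier by simp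
  have "cadj ?U * ?U = 1\<^sub>m (n * m)"
  proof (rule eq_matI)
    fix r s assume "r < dim_row (1\<^sub>m (n * m) :: complex mat)" "s < dim_col (1\<^sub>m (n * m) :: complex mat)"
    then have rs: "r < m * n" "s < m * n" by (auto simp: mult.commute)
    obtain \<alpha> i L j \<beta> k L' l where ir: "index m r = (\<alpha>,i,L,j)" and iy: "index m s = (\<beta>,k,L',l)"
      by (metis prod_cases4)
    note R = index_range[OF rs(1) ir] and S = index_range[OF rs(2) iy]
    have "(cadj ?U * ?U) $$ (r,s) = (\<Sum>y<n * m. cnj (?U $$ (y,r)) * ?U $$ (y,s))"
      using rs right_fourier_carrier[of m]
      by (subst mat_mult_entry[OF U' right_fourier_carrier]) (auto simp: cadj_index mult.commute)
    also have "\<dots> = (\<Sum>b<n. cnj (?U $$ (b * m + L', r)) * cnj (coeff \<beta> k l (e b)))"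
      by (rule right_fourier_sum[OF rs(2) iy])
    also have "\<dots> = (\<Sum>b<n. if L = L' then coeff \<alpha> i j (e b) * cnj (coeff \<beta> k l (e b)) else 0)"
      using rs ir S pair_less[of _ n L' m] by (intro sum.cong refl) (auto simp: right_fourier_def mult.commute)
    also have "\<dots> = (if L = L' then (\<Sum>g\<in>carrier G. coeff \<alpha> i j g * cnj (coeff \<beta> k l g)) else 0)"
      using sum_enum[of "\<lambda>g. coeff \<alpha> i j g * cnj (coeff \<beta> k l g)"] by simp
    also have "\<dots> = (if index m r = index m s then 1 else 0)"
      using coeff_orthonormal[OF R(1,2,4) S(1,2,4)] ir iy by auto
    also have "\<dots> = (1\<^sub>m (n * m)) $$ (r,s)" using rs by (simp add: index_inj mult.commute)
    finally show "(cadj ?U * ?U) $$ (r,s) = (1\<^sub>m (n * m)) $$ (r,s)" .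
  qed (use right_fourier_carrier[of m] in auto)
  then show ?thesis
    using mat_mult_left_right_inverse[OF U' right_fourier_carrier] right_fourier_carrier
    by (simp add: unitary_mat_def)
qed

text \<open>The coefficient indices are transposed: row L d + j and column R d + l use the
  coefficient (l, j). Right translation by h sends the coefficient (i, j) to the combination of the
  (i, l) with weights \<rho>(h) at (l, j), and j labels rows of the transformed W while l labels
  columns.\<close>

definition X_coeff :: "nat \<times> nat \<times> nat \<Rightarrow> nat \<times> 'a \<times> nat \<Rightarrow> complex" where
  "X_coeff = (\<lambda>(\<alpha>,p,q) (L,g,R). if p div ds ! \<alpha> = L \<and> q div ds ! \<alpha> = R
     then coeff \<alpha> (q mod ds ! \<alpha>) (p mod ds ! \<alpha>) g else 0)"

text \<open>The entries of all blocks form one index set, so a single unitary map yields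
  independence within and between blocks.\<close>

definition X_index :: "nat \<Rightarrow> nat \<Rightarrow> (nat \<times> nat \<times> nat) set" where
  "X_index dL dR = {(\<alpha>,p,q). \<alpha> < length ds \<and> p < dL * ds ! \<alpha> \<and> q < dR * ds ! \<alpha>}"

definition X_mat :: "nat \<Rightarrow> nat \<Rightarrow> (nat \<Rightarrow> 'a \<Rightarrow> nat \<Rightarrow> complex) \<Rightarrow> nat \<Rightarrow> complex mat" where
  "X_mat dL dR c \<alpha> = mat (dL * ds ! \<alpha>) (dR * ds ! \<alpha>)
     (\<lambda>(p,q). \<Sum>(L,g,R)\<in>{..<dL} \<times> carrier G \<times> {..<dR}. X_coeff (\<alpha>,p,q) (L,g,R) * c L g R)"

lemma X_coeff_sum:
  assumes "(\<alpha>,p,q) \<in> X_index dL dR"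
  shows "(\<Sum>(L,g,R)\<in>{..<dL} \<times> carrier G \<times> {..<dR}. X_coeff (\<alpha>,p,q) (L,g,R) * f L g R)
    = (\<Sum>g\<in>carrier G. coeff \<alpha> (q mod ds ! \<alpha>) (p mod ds ! \<alpha>) g * f (p div ds ! \<alpha>) g (q div ds ! \<alpha>))"
proof -
  let ?d = "ds ! \<alpha>"
  have pq: "p div ?d < dL" "q div ?d < dR"
    using assms by (auto simp: X_index_def intro: div_less_of_less_mult)
  have "(\<Sum>(L,g,R)\<in>{..<dL} \<times> carrier G \<times> {..<dR}. X_coeff (\<alpha>,p,q) (L,g,R) * f L g R)
    = (\<Sum>L<dL. \<Sum>g\<in>carrier G. \<Sum>R<dR. X_coeff (\<alpha>,p,q) (L,g,R) * f L g R)"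
    by (simp add: sum.cartesian_product)
  also have "\<dots> = (\<Sum>L<dL. if L = p div ?d then
      (\<Sum>g\<in>carrier G. \<Sum>R<dR. if R = q div ?d then coeff \<alpha> (q mod ?d) (p mod ?d) g * f (p div ?d) g (q div ?d) else 0) else 0)"
  proof (intro sum.cong refl)
    fix L
    have "X_coeff (\<alpha>,p,q) (L,g,R) * f L g R = (if L = p div ?d then
        (if R = q div ?d then coeff \<alpha> (q mod ?d) (p mod ?d) g * f (p div ?d) g (q div ?d) else 0) else 0)" for g R
      by (auto simp: X_coeff_def)
    then show "(\<Sum>g\<in>carrier G. \<Sum>R<dR. X_coeff (\<alpha>,p,q) (L,g,R) * f L g R) = (if L = p div ?d then
      (\<Sum>g\<in>carrier G. \<Sum>R<dR. if R = q div ?d then coeff \<alpha> (q mod ?d) (p mod ?d) g * f (p div ?d) g (q div ?d) else 0) else 0)"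
      by simp
  qed
  finally show ?thesis using pq by simp
qed

lemma card_X_index: "card (X_index dL dR) = card ({..<dL} \<times> carrier G \<times> {..<dR})"
  and finite_X_index: "finite (X_index dL dR)"
proof -
  have *: "X_index dL dR = (SIGMA \<alpha>:{..<length ds}. {..<dL * ds ! \<alpha>} \<times> {..<dR * ds ! \<alpha>})"
    by (auto simp: X_index_def)
  show "finite (X_index dL dR)" unfolding * by simp
  have "card (X_index dL dR) = (\<Sum>\<alpha><length ds. dL * dR * (ds ! \<alpha>)\<^sup>2)"
    unfolding * by (simp add: power2_eq_square mult_ac)
  then show "card (X_index dL dR) = card ({..<dL} \<times> carrier G \<times> {..<dR})"
    by (simp add: sum_squares_dims card_cartesian_product flip: sum_distrib_left)
qed

text \<open>Rows with different pairs (L, R) have disjoint supports; for a fixed pair the rows are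
  the orthonormal functions \<open>coeff\<close>. Quotient and remainder by the dimension recover p
  and q.\<close>

lemma X_coeff_unitary: "unitary_family (X_index dL dR) ({..<dL} \<times> carrier G \<times> {..<dR}) X_coeff"
proof (rule orthonormal_rows_imp_columns[OF finite_X_index _ card_X_index])
  show "finite ({..<dL} \<times> carrier G \<times> {..<dR})" using finite_G by simp
  fix a b assume ab: "a \<in> X_index dL dR" "b \<in> X_index dL dR"
  obtain \<alpha> p q \<beta> p' q' where a: "a = (\<alpha>,p,q)" and b: "b = (\<beta>,p',q')" by (metis prod_cases3)
  have \<alpha>: "\<alpha> < length ds" "q mod ds ! \<alpha> < ds ! \<alpha>" "p mod ds ! \<alpha> < ds ! \<alpha>"
    and \<beta>: "\<beta> < length ds" "q' mod ds ! \<beta> < ds ! \<beta>" "p' mod ds ! \<beta> < ds ! \<beta>"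
    using ab a b ds_pos by (auto simp: X_index_def)
  have "(\<Sum>k\<in>{..<dL} \<times> carrier G \<times> {..<dR}. X_coeff a k * cnj (X_coeff b k))
    = (\<Sum>(L,g,R)\<in>{..<dL} \<times> carrier G \<times> {..<dR}. X_coeff (\<alpha>,p,q) (L,g,R) * cnj (X_coeff b (L,g,R)))"
    by (simp add: a split_def)
  also have "\<dots> = (\<Sum>g\<in>carrier G. coeff \<alpha> (q mod ds ! \<alpha>) (p mod ds ! \<alpha>) g *
      cnj (X_coeff b (p div ds ! \<alpha>, g, q div ds ! \<alpha>)))"
    using ab a by (intro X_coeff_sum) simp
  also have "\<dots> = (if p' div ds ! \<beta> = p div ds ! \<alpha> \<and> q' div ds ! \<beta> = q div ds ! \<alpha> then
      (\<Sum>g\<in>carrier G. coeff \<alpha> (q mod ds ! \<alpha>) (p mod ds ! \<alpha>) g * cnj (coeff \<beta> (q' mod ds ! \<beta>) (p' mod ds ! \<beta>) g)) else 0)"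
    by (cases "p' div ds ! \<beta> = p div ds ! \<alpha> \<and> q' div ds ! \<beta> = q div ds ! \<alpha>")
      (simp_all only: b X_coeff_def prod.case if_True if_False complex_cnj_zero mult_zero_right sum.neutral_const simp_thms)
  also have "\<dots> = (if a = b then 1 else 0)"
    unfolding coeff_orthonormal[OF \<alpha> \<beta>] a b by (auto, (metis div_mult_mod_eq)+)
  finally show "(\<Sum>k\<in>{..<dL} \<times> carrier G \<times> {..<dR}. X_coeff a k * cnj (X_coeff b k)) = (if a = b then 1 else 0)" .
qed

section \<open>Block form of W in the coefficient basis\<close>

lemma fourier_W_entry:
  assumes r: "r < dL * n" and s: "s < dR * n"
    and ir: "index dL r = (\<alpha>,i,L,j)" and iy: "index dR s = (\<beta>,k,R,l)"
  shows "(left_fourier dL * W_mat G e \<omega> dL dR c * right_fourier dR) $$ (r,s)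
    = (if \<alpha> = \<beta> \<and> i = k then of_real (1 / sqrt (real n)) * (\<Sum>h\<in>carrier G. (reps ! \<alpha>) h $$ (l,j) * c L h R) else 0)"
proof -
  let ?W = "W_mat G e \<omega> dL dR c" and ?t = "complex_of_real (1 / sqrt (real n))"
  have W: "?W \<in> carrier_mat (dL * n) (n * dR)" by (simp add: W_mat_def Let_def)
  have s': "s < n * dR" using s by (simp add: mult.commute)
  note A = index_range[OF r ir] and B = index_range[OF s iy]
  have LW: "left_fourier dL * ?W \<in> carrier_mat (dL * n) (n * dR)"
    by (rule mult_carrier_mat[OF left_fourier_carrier W])
  have Went: "?W $$ (L * n + a, b * dR + R) =
      ?t * \<omega> (e b) (inv (e b) \<otimes> e a) * c L (inv (e b) \<otimes> e a) R" if "a < n" "b < n" for a b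
    using that pair_less[OF A(3) that(1)] pair_less[OF that(2) B(3)] B(3) by (simp add: W_mat_def Let_def)
  have "(left_fourier dL * ?W * right_fourier dR) $$ (r,s)
      = (\<Sum>z<n * dR. (left_fourier dL * ?W) $$ (r,z) * right_fourier dR $$ (z,s))"
    by (rule mat_mult_entry[OF LW right_fourier_carrier r s'])
  also have "\<dots> = (\<Sum>b<n. (left_fourier dL * ?W) $$ (r,b * dR + R) * cnj (coeff \<beta> k l (e b)))"
    by (rule right_fourier_sum[OF s iy])
  also have "\<dots> = (\<Sum>b<n. (\<Sum>a<n. coeff \<alpha> i j (e a) *
      (?t * \<omega> (e b) (inv (e b) \<otimes> e a) * c L (inv (e b) \<otimes> e a) R)) * cnj (coeff \<beta> k l (e b)))"
  proof (rule sum.cong[OF refl])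
    fix b assume "b \<in> {..<n}"
    then have b: "b < n" by simp
    have "(left_fourier dL * ?W) $$ (r,b * dR + R) = (\<Sum>a<n. coeff \<alpha> i j (e a) * ?W $$ (L * n + a, b * dR + R))"
      using mat_mult_entry[OF left_fourier_carrier W r pair_less[OF b B(3)]] left_fourier_sum[OF r ir] by simp
    then show "(left_fourier dL * ?W) $$ (r,b * dR + R) * cnj (coeff \<beta> k l (e b)) = (\<Sum>a<n. coeff \<alpha> i j (e a) *
      (?t * \<omega> (e b) (inv (e b) \<otimes> e a) * c L (inv (e b) \<otimes> e a) R)) * cnj (coeff \<beta> k l (e b))"
      using Went b by simp
  qed
  also have "\<dots> = (\<Sum>g\<in>carrier G. (\<Sum>g'\<in>carrier G. coeff \<alpha> i j g' *
      (?t * \<omega> g (inv g \<otimes> g') * c L (inv g \<otimes> g') R)) * cnj (coeff \<beta> k l g))"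
    unfolding sum_enum[symmetric, of "\<lambda>g. (\<Sum>g'\<in>carrier G. coeff \<alpha> i j g' *
      (?t * \<omega> g (inv g \<otimes> g') * c L (inv g \<otimes> g') R)) * cnj (coeff \<beta> k l g)"]
    by (subst sum_enum[symmetric]) simp
  also have "\<dots> = (\<Sum>g\<in>carrier G. (\<Sum>h\<in>carrier G. \<Sum>m<ds ! \<alpha>.
      ?t * c L h R * (reps ! \<alpha>) h $$ (m,j) * coeff \<alpha> i m g) * cnj (coeff \<beta> k l g))"
  proof (rule sum.cong[OF refl])
    fix g assume g: "g \<in> carrier G"
    \<comment> \<open>Substituting \<open>g \<otimes> h\<close> for g' turns the group argument of c
      into h, which does not depend on g.\<close>
    have "(\<Sum>g'\<in>carrier G. coeff \<alpha> i j g' * (?t * \<omega> g (inv g \<otimes> g') * c L (inv g \<otimes> g') R))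
      = (\<Sum>h\<in>carrier G. coeff \<alpha> i j (g \<otimes> h) * (?t * \<omega> g (inv g \<otimes> (g \<otimes> h)) * c L (inv g \<otimes> (g \<otimes> h)) R))"
      by (rule sum_translate[OF g])
    also have "\<dots> = (\<Sum>h\<in>carrier G. ?t * c L h R * (\<omega> g h * coeff \<alpha> i j (g \<otimes> h)))"
      using g by (intro sum.cong refl) (simp flip: m_assoc)
    also have "\<dots> = (\<Sum>h\<in>carrier G. \<Sum>m<ds ! \<alpha>. ?t * c L h R * (reps ! \<alpha>) h $$ (m,j) * coeff \<alpha> i m g)"
      using coeff_mult[OF A(1,2,4) g] by (intro sum.cong refl) (simp add: sum_distrib_left mult_ac)
    finally show "(\<Sum>g'\<in>carrier G. coeff \<alpha> i j g' *
      (?t * \<omega> g (inv g \<otimes> g') * c L (inv g \<otimes> g') R)) * cnj (coeff \<beta> k l g)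
      = (\<Sum>h\<in>carrier G. \<Sum>m<ds ! \<alpha>.
      ?t * c L h R * (reps ! \<alpha>) h $$ (m,j) * coeff \<alpha> i m g) * cnj (coeff \<beta> k l g)" by simp
  qed
  \<comment> \<open>What still depends on g is an inner product of two coefficients. It forces equal
    blocks, equal copies i = k, and m = l.\<close>
  also have "\<dots> = (\<Sum>h\<in>carrier G. \<Sum>m<ds ! \<alpha>. ?t * c L h R * (reps ! \<alpha>) h $$ (m,j) *
      (\<Sum>g\<in>carrier G. coeff \<alpha> i m g * cnj (coeff \<beta> k l g)))"
    unfolding sum_distrib_left sum_distrib_right
    by (subst sum.swap, rule sum.cong[OF refl], subst sum.swap) (simp add: mult.assoc)
  also have "\<dots> = (\<Sum>h\<in>carrier G. \<Sum>m<ds ! \<alpha>. if m = l then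
      (if \<alpha> = \<beta> \<and> i = k then ?t * ((reps ! \<alpha>) h $$ (l,j) * c L h R) else 0) else 0)"
    using coeff_orthonormal[OF A(1,2) _ B(1,2,4)] by (intro sum.cong refl) (auto simp: mult_ac)
  also have "\<dots> = (if \<alpha> = \<beta> \<and> i = k then ?t * (\<Sum>h\<in>carrier G. (reps ! \<alpha>) h $$ (l,j) * c L h R) else 0)"
    using B by (auto simp: sum_distrib_left)
  finally show ?thesis .
qed

lemma fourier_W:
  "left_fourier dL * W_mat G e \<omega> dL dR c * right_fourier dR
    = block_diag (map (\<lambda>\<alpha>. kron_id (ds ! \<alpha>)
        (complex_of_real (1 / sqrt (real (ds ! \<alpha>))) \<cdot>\<^sub>m X_mat dL dR c \<alpha>)) [0..<length ds])"
  (is "?L = block_diag ?Bs")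
proof (rule eq_matI)
  have sizes: "map dim_row ?Bs = sizes dL" "map dim_col ?Bs = sizes dR"
    by (auto simp: sizes_def X_mat_def intro!: nth_equalityI)
  fix r s assume "r < dim_row (block_diag ?Bs)" "s < dim_col (block_diag ?Bs)"
  then have rs: "r < dL * n" "s < dR * n" by (simp_all only: dim_block_diag sizes sum_sizes)
  obtain \<alpha> p \<beta> q where d: "block_pos (sizes dL) r = (\<alpha>,p)" "block_pos (sizes dR) s = (\<beta>,q)" by fastforce
  have \<alpha>: "\<alpha> < length ds" "p < ds ! \<alpha> * (dL * ds ! \<alpha>)"
    using block_pos_range[of r "sizes dL"] rs d by (auto simp: sum_sizes) (auto simp: sizes_def)
  have \<beta>: "\<beta> < length ds" "q < ds ! \<beta> * (dR * ds ! \<beta>)"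
    using block_pos_range[of s "sizes dR"] rs d by (auto simp: sum_sizes) (auto simp: sizes_def)
  let ?d = "ds ! \<alpha>"
  define p' where "p' = p mod (dL * ?d)"
  define q' where "q' = q mod (dR * ds ! \<beta>)"
  have ir: "index dL r = (\<alpha>, p div (dL * ?d), p' div ?d, p' mod ?d)"
    and iy: "index dR s = (\<beta>, q div (dR * ds ! \<beta>), q' div ds ! \<beta>, q' mod ds ! \<beta>)"
    using d by (simp_all add: index_def Let_def p'_def q'_def)
  have "block_diag ?Bs $$ (r,s) = (if \<alpha> = \<beta> then (?Bs ! \<alpha>) $$ (p,q) else 0)"
    using rs d by (subst block_diag_index) (simp_all only: sizes sum_sizes, simp)
  also have "\<dots> = ?L $$ (r,s)"
  proof (cases "\<alpha> = \<beta> \<and> p div (dL * ?d) = q div (dR * ?d)")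
    case True
    have p': "p' < dL * ?d" and q': "q' < dR * ?d"
      using \<alpha> \<beta> True mod_less_of_less_mult by (auto simp: p'_def q'_def)
    have "(?Bs ! \<alpha>) $$ (p,q) = of_real (1 / sqrt (real ?d)) * X_mat dL dR c \<alpha> $$ (p',q')"
      using conjunct1[OF True, symmetric] conjunct2[OF True] \<alpha> \<beta> p' q'
      by (simp add: kron_id_def X_mat_def p'_def q'_def)
    also have "X_mat dL dR c \<alpha> $$ (p',q')
        = (\<Sum>g\<in>carrier G. coeff \<alpha> (q' mod ?d) (p' mod ?d) g * c (p' div ?d) g (q' div ?d))"
      using X_coeff_sum[of \<alpha> p' q' dL dR c] \<alpha> p' q' by (simp add: X_mat_def X_index_def)
    also have "of_real (1 / sqrt (real ?d)) * \<dots> = of_real (1 / sqrt (real n)) *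
        (\<Sum>h\<in>carrier G. (reps ! \<alpha>) h $$ (q' mod ?d, p' mod ?d) * c (p' div ?d) h (q' div ?d))"
    proof -
      \<comment> \<open>Origin of the scale of the blocks: W carries 1 / sqrt |G|, the orthonormal
        coefficients carry sqrt (d / |G|), and the quotient is 1 / sqrt d.\<close>
      have "1 / sqrt (real ?d) * sqrt (real ?d / real n) = 1 / sqrt (real n)"
        using ds_pos[OF \<alpha>(1)] by (simp add: real_sqrt_divide)
      then have "complex_of_real (1 / sqrt (real ?d)) * of_real (sqrt (real ?d / real n)) = of_real (1 / sqrt (real n))"
        by (simp only: flip: of_real_mult)
      then show ?thesis
        unfolding coeff_def sum_distrib_left by (intro sum.cong refl) (simp only: mult.assoc[symmetric])
    qed
    finally show ?thesis
      using conjunct1[OF True, symmetric] conjunct2[OF True] fourier_W_entry[OF rs ir iy] by simp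
  next
    case False
    then show ?thesis
      using fourier_W_entry[OF rs ir iy] \<alpha> \<beta> by (auto simp: kron_id_def X_mat_def)
  qed
  finally show "?L $$ (r,s) = block_diag ?Bs $$ (r,s)" by simp
next
  have sizes: "map dim_row ?Bs = sizes dL" "map dim_col ?Bs = sizes dR"
    by (auto simp: sizes_def X_mat_def intro!: nth_equalityI)
  show "dim_row ?L = dim_row (block_diag ?Bs)" "dim_col ?L = dim_col (block_diag ?Bs)"
    unfolding dim_block_diag sizes sum_sizes
    using left_fourier_carrier[of dL] right_fourier_carrier[of dR] by (simp_all add: mult.commute)
qed

text \<open>The right transform cancels against its adjoint, so the left side is the transformed W
  times its own adjoint. The product is then taken block by block, and the two factors 1 / sqrt d
  give 1 / d.\<close>

lemma fourier_WW:
  fixes c :: "nat \<Rightarrow> 'a \<Rightarrow> nat \<Rightarrow> complex" and dL dR :: nat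
  defines "W \<equiv> W_mat G e \<omega> dL dR c"
  shows "left_fourier dL * (W * cadj W) * cadj (left_fourier dL)
    = block_diag (map (\<lambda>\<alpha>. kron_id (ds ! \<alpha>)
        (complex_of_real (1 / real (ds ! \<alpha>)) \<cdot>\<^sub>m (X_mat dL dR c \<alpha> * cadj (X_mat dL dR c \<alpha>)))) [0..<length ds])"
proof -
  let ?U = "left_fourier dL" and ?V = "right_fourier dR" and ?X = "X_mat dL dR c"
  let ?Y = "\<lambda>\<alpha>. complex_of_real (1 / sqrt (real (ds ! \<alpha>))) \<cdot>\<^sub>m ?X \<alpha>"
  let ?B = "\<lambda>\<alpha>. kron_id (ds ! \<alpha>) (?Y \<alpha>)"
  have W: "W \<in> carrier_mat (dL * n) (n * dR)" by (simp add: W_def W_mat_def Let_def)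
  have U: "?U \<in> carrier_mat (dL * n) (dL * n)" and V: "?V \<in> carrier_mat (n * dR) (n * dR)"
    by (rule left_fourier_carrier right_fourier_carrier)+
  note c = W U V cadj_carrier[OF W] cadj_carrier[OF U] cadj_carrier[OF V]
  have UW: "?U * W \<in> carrier_mat (dL * n) (n * dR)" using c by auto
  have VV: "?V * cadj ?V = 1\<^sub>m (n * dR)" using unitary_right_fourier by (simp add: unitary_mat_def)
  have "(?U * W * ?V) * cadj (?U * W * ?V) = (?U * W * ?V) * (cadj ?V * cadj (?U * W))"
    by (simp only: cadj_mult[OF UW V])
  also have "\<dots> = ?U * W * (?V * (cadj ?V * cadj (?U * W)))"
    by (rule assoc_mult_mat[OF UW V]) (use c UW in auto)
  also have "?V * (cadj ?V * cadj (?U * W)) = (?V * cadj ?V) * cadj (?U * W)"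
    by (rule assoc_mult_mat[symmetric, OF V c(6) cadj_carrier[OF UW]])
  also have "\<dots> = cadj (?U * W)"
    unfolding VV by (rule left_mult_one_mat[OF cadj_carrier[OF UW]])
  also have "\<dots> = cadj W * cadj ?U" by (rule cadj_mult[OF U W])
  also have "?U * W * (cadj W * cadj ?U) = ?U * (W * (cadj W * cadj ?U))"
    by (rule assoc_mult_mat[OF U W]) (use c in auto)
  also have "W * (cadj W * cadj ?U) = W * cadj W * cadj ?U"
    by (rule assoc_mult_mat[symmetric, OF W c(4,5)])
  also have "?U * (W * cadj W * cadj ?U) = ?U * (W * cadj W) * cadj ?U"
    by (rule assoc_mult_mat[symmetric, OF U _ c(5)]) (use c in auto)
  finally have "?U * (W * cadj W) * cadj ?U = (?U * W * ?V) * cadj (?U * W * ?V)" ..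
  also have "\<dots> = block_diag (map ?B [0..<length ds]) * block_diag (map (cadj \<circ> ?B) [0..<length ds])"
    unfolding W_def fourier_W cadj_block_diag by simp
  also have "\<dots> = block_diag (map2 (*) (map ?B [0..<length ds]) (map (cadj \<circ> ?B) [0..<length ds]))"
    by (rule block_diag_mult) (auto simp: set_zip)
  also have "map2 (*) (map ?B [0..<length ds]) (map (cadj \<circ> ?B) [0..<length ds])
      = map (\<lambda>\<alpha>. ?B \<alpha> * cadj (?B \<alpha>)) [0..<length ds]"
    by (rule nth_equalityI) auto
  also have "\<dots> = map (\<lambda>\<alpha>. kron_id (ds ! \<alpha>)
      (complex_of_real (1 / real (ds ! \<alpha>)) \<cdot>\<^sub>m (?X \<alpha> * cadj (?X \<alpha>)))) [0..<length ds]"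
  proof (rule map_cong[OF refl])
    fix \<alpha> assume "\<alpha> \<in> set [0..<length ds]"
    let ?d = "ds ! \<alpha>"
    have X: "?X \<alpha> \<in> carrier_mat (dL * ?d) (dR * ?d)" by (simp add: X_mat_def)
    then have Y: "?Y \<alpha> \<in> carrier_mat (dL * ?d) (dR * ?d)" by simp
    have "?B \<alpha> * cadj (?B \<alpha>) = kron_id ?d (?Y \<alpha> * cadj (?Y \<alpha>))"
      unfolding cadj_kron_id by (rule kron_id_mult[OF Y cadj_carrier[OF Y]])
    also have "?Y \<alpha> * cadj (?Y \<alpha>) = complex_of_real (1 / sqrt (real ?d)) \<cdot>\<^sub>m
        (complex_of_real (1 / sqrt (real ?d)) \<cdot>\<^sub>m (?X \<alpha> * cadj (?X \<alpha>)))"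
      unfolding cadj_smult complex_cnj_complex_of_real
      by (simp only: mult_smult_assoc_mat[OF X smult_carrier_mat[OF cadj_carrier[OF X]]]
          mult_smult_distrib[OF X cadj_carrier[OF X]])
    also have "\<dots> = complex_of_real (1 / real ?d) \<cdot>\<^sub>m (?X \<alpha> * cadj (?X \<alpha>))"
    proof -
      have "complex_of_real (1 / sqrt (real ?d)) * complex_of_real (1 / sqrt (real ?d)) = complex_of_real (1 / real ?d)"
        by (simp flip: of_real_mult)
      then show ?thesis by (intro eq_matI) (simp_all del: index_mult_mat(1) flip: mult.assoc)
    qed
    finally show "?B \<alpha> * cadj (?B \<alpha>) = kron_id ?d (complex_of_real (1 / real ?d) \<cdot>\<^sub>m (?X \<alpha> * cadj (?X \<alpha>)))" .
  qed
  finally show ?thesis .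
qed

end

theorem theorem1:
  fixes G :: "'g monoid" and \<omega> :: "'g \<Rightarrow> 'g \<Rightarrow> complex"
    and e :: "nat \<Rightarrow> 'g" and dL dR :: nat
    and M :: "'s measure" and c :: "nat \<Rightarrow> 'g \<Rightarrow> nat \<Rightarrow> 's \<Rightarrow> complex"
    and ds :: "nat list" and reps :: "('g \<Rightarrow> complex mat) list"
  assumes "group G" and "finite (carrier G)"
    and "normalized_U1_2cocycle G \<omega>"
    and "dL > 0" and "dR > 0"
    and "bij_betw e {..<card (carrier G)} (carrier G)"
    and "prob_space M"
    and "prob_space.indep_vars M (\<lambda>_. borel) (\<lambda>(L, g, R). c L g R)
           ({..<dL} \<times> carrier G \<times> {..<dR})"
    and "\<And>L g R. L < dL \<Longrightarrow> g \<in> carrier G \<Longrightarrow> R < dR \<Longrightarrow>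
           distributed M lborel (c L g R) std_complex_gaussian_density"
    and "complete_irrep_system G \<omega> ds reps"
  shows "\<exists>U1 U2 X.
     unitary_mat (dL * card (carrier G)) U1 \<and>
     unitary_mat (card (carrier G) * dR) U2 \<and>
     (\<forall>\<alpha> < length ds. \<forall>x\<in>space M. X \<alpha> x \<in> carrier_mat (dL * ds ! \<alpha>) (dR * ds ! \<alpha>)) \<and>
     prob_space.indep_vars M (\<lambda>_. borel) (\<lambda>(\<alpha>, i, j) x. X \<alpha> x $$ (i, j))
       {(\<alpha>, i, j). \<alpha> < length ds \<and> i < dL * ds ! \<alpha> \<and> j < dR * ds ! \<alpha>} \<and>
     (\<forall>\<alpha> i j. \<alpha> < length ds \<longrightarrow> i < dL * ds ! \<alpha> \<longrightarrow> j < dR * ds ! \<alpha> \<longrightarrow>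
        distributed M lborel (\<lambda>x. X \<alpha> x $$ (i, j)) std_complex_gaussian_density) \<and>
     (\<forall>x\<in>space M.
        U1 * W_mat G e \<omega> dL dR (\<lambda>L g R. c L g R x) * U2 =
          block_diag (map (\<lambda>\<alpha>. kron_id (ds ! \<alpha>)
              (complex_of_real (1 / sqrt (real (ds ! \<alpha>))) \<cdot>\<^sub>m X \<alpha> x)) [0..<length ds]) \<and>
        U1 * (W_mat G e \<omega> dL dR (\<lambda>L g R. c L g R x) *
              cadj (W_mat G e \<omega> dL dR (\<lambda>L g R. c L g R x))) * cadj U1 =
          block_diag (map (\<lambda>\<alpha>. kron_id (ds ! \<alpha>)
              (complex_of_real (1 / real (ds ! \<alpha>)) \<cdot>\<^sub>m (X \<alpha> x * cadj (X \<alpha> x)))) [0..<length ds]))"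
proof -
  interpret group G by fact
  interpret irrep_system G \<omega> e ds reps
    by unfold_locales (use assms in auto)
  interpret prob_space M by fact
  let ?K = "{..<dL} \<times> carrier G \<times> {..<dR}"
  define X where "X \<alpha> x = X_mat dL dR (\<lambda>L g R. c L g R x) \<alpha>" for \<alpha> x
  \<comment> \<open>Positivity of dL and dR enters here: nonemptiness is what provides the
    normalisation of the Gaussian density.\<close>
  have ne: "?K \<noteq> {}" using assms(4,5) by auto
  have gauss: "distributed M lborel ((\<lambda>(L,g,R). c L g R) k) std_complex_gaussian_density" if "k \<in> ?K" for k
    using that assms(9) by (cases k) auto
  \<comment> \<open>Asserted only for indices within the matrix bounds. Independence is therefore
    transferred by congruence on \<open>X_index\<close>.\<close>
  have entry: "X \<alpha> x $$ (p,q) = (\<Sum>k\<in>?K. X_coeff (\<alpha>,p,q) k * (\<lambda>(L,g,R). c L g R) k x)"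
    if "(\<alpha>,p,q) \<in> X_index dL dR" for \<alpha> p q x
    using that by (simp add: X_def X_mat_def X_index_def split_def)
  note gfu = gaussian_family_unitary[OF X_coeff_unitary prob_space_axioms ne assms(8)]
  have "indep_vars (\<lambda>_. borel) (\<lambda>(\<alpha>, i, j) x. X \<alpha> x $$ (i, j)) (X_index dL dR) \<longleftrightarrow>
      indep_vars (\<lambda>_. borel) (\<lambda>i x. \<Sum>k\<in>?K. X_coeff i k * (\<lambda>(L,g,R). c L g R) k x) (X_index dL dR)"
    by (rule indep_vars_cong) (auto simp: entry fun_eq_iff)
  then have "indep_vars (\<lambda>_. borel) (\<lambda>(\<alpha>, i, j) x. X \<alpha> x $$ (i, j))
       {(\<alpha>, i, j). \<alpha> < length ds \<and> i < dL * ds ! \<alpha> \<and> j < dR * ds ! \<alpha>}"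
    using gfu(1)[OF gauss] by (simp add: X_index_def)
  moreover have "distributed M lborel (\<lambda>x. X \<alpha> x $$ (i, j)) std_complex_gaussian_density"
    if "\<alpha> < length ds" "i < dL * ds ! \<alpha>" "j < dR * ds ! \<alpha>" for \<alpha> i j
  proof -
    have mem: "(\<alpha>,i,j) \<in> X_index dL dR" using that by (simp add: X_index_def)
    show ?thesis unfolding entry[OF mem] by (rule gfu(2)[OF gauss mem])
  qed
  moreover have "X \<alpha> x \<in> carrier_mat (dL * ds ! \<alpha>) (dR * ds ! \<alpha>)" for \<alpha> x
    by (simp add: X_def X_mat_def)
  ultimately show ?thesis
    using unitary_left_fourier[of dL] unitary_right_fourier[of dR] fourier_W fourier_WW
    unfolding X_def by (intro exI[of _ "left_fourier dL"] exI[of _ "right_fourier dR"] exI[of _ X]) (simp add: X_def)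
qed

end
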